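(* Let $b,c\ge 4$ be integers with $b\equiv c\equiv 0 \pmod 3$ or $b\equiv c\equiv 1\pmod 3$. Then the grid $(4,b,c)$ is perfect; that is, there is a set $A_0\subseteq[4]\times[b]\times[c]$ with $|A_0| = (4b+4c+bc)/3$ that percolates under the $3$-neighbour bootstrap percolation process on $P_4\Box P_b\Box P_c$.
   Context: For positive integers $a,b,c$, the grid $(a,b,c)$ is the graph $P_a\Box P_b\Box P_c$ with vertex set $[a]\times[b]\times[c]$, two vertices being adjacent iff they differ by exactly $1$ in exactly one coordinate and agree in the others. In the $3$-neighbour bootstrap percolation process, starting from $A_0\subseteq V(G)$, one sets $A_t = A_{t-1}\cup\{v : |N(v)\cap A_{t-1}|\ge 3\}$ for $t\ge1$; $A_0$ percolates if $\bigcup_t A_t = V(G)$. The grid $(a,b,c)$ is called perfect if it has a percolating set of size exactly $(ab+ac+bc)/3$ (this being an integer). *)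

theory Defs
  imports Main
begin

type_synonym vertex3 = "nat \<times> nat \<times> nat"

definition grid_verts :: "nat \<Rightarrow> nat \<Rightarrow> nat \<Rightarrow> vertex3 set" where
  "grid_verts a b c = {1..a} \<times> {1..b} \<times> {1..c}"

definition path_adj :: "nat \<Rightarrow> nat \<Rightarrow> bool" where
  "path_adj i j \<longleftrightarrow> i = j + 1 \<or> j = i + 1"

fun grid_adj :: "vertex3 \<Rightarrow> vertex3 \<Rightarrow> bool" where
  "grid_adj (x, y, z) (x', y', z') \<longleftrightarrow>
     (path_adj x x' \<and> y = y' \<and> z = z') \<or>
     (x = x' \<and> path_adj y y' \<and> z = z') \<or>
     (x = x' \<and> y = y' \<and> path_adj z z')"

text \<open>The process is defined for a graph given by its vertex set \<open>V\<close> and adjacency relation \<open>E\<close>.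
  Neighbourhoods are assumed to be finite, since \<^const>\<open>card\<close> is \<open>0\<close> on infinite sets.\<close>

definition neighbours :: "'a set \<Rightarrow> ('a \<Rightarrow> 'a \<Rightarrow> bool) \<Rightarrow> 'a \<Rightarrow> 'a set" where
  "neighbours V E v = {u \<in> V. E v u}"

primrec infected ::
  "nat \<Rightarrow> 'a set \<Rightarrow> ('a \<Rightarrow> 'a \<Rightarrow> bool) \<Rightarrow> 'a set \<Rightarrow> nat \<Rightarrow> 'a set" where
  "infected r V E A 0 = A"
| "infected r V E A (Suc t) =
     infected r V E A t \<union> {v \<in> V. card (neighbours V E v \<inter> infected r V E A t) \<ge> r}"

definition percolates :: "nat \<Rightarrow> 'a set \<Rightarrow> ('a \<Rightarrow> 'a \<Rightarrow> bool) \<Rightarrow> 'a set \<Rightarrow> bool" where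
  "percolates r V E A \<longleftrightarrow> A \<subseteq> V \<and> (\<Union>t. infected r V E A t) = V"

definition perfect_grid :: "nat \<Rightarrow> nat \<Rightarrow> nat \<Rightarrow> bool" where
  "perfect_grid a b c \<longleftrightarrow>
     3 dvd (a * b + a * c + b * c) \<and>
     (\<exists>A. percolates 3 (grid_verts a b c) grid_adj A \<and>
          card A = (a * b + a * c + b * c) div 3)"

end

theory Submission
  imports Defs
begin

text \<open>
  If the four bricks in alternate octants of a grid are infected, then so is the whole grid, because
  every other vertex eventually has three infected neighbours, one in each direction towards the
  point where the octants meet. The numbers of seeds in perfect grids add up, so perfect grids of
  thickness 4 can be glued from perfect grids of thickness 2. The latter, as well as some narrow
  grids of thickness 4, are given by pictures in which a block of rows and a block of columns may be
  repeated. Infection consumes such a picture one group of columns at a time, running up and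
  down the group, so that percolation for all numbers of repetitions follows from finitely many
  local computations, each of which is repeated along the group. The pictures were found by
  simulated annealing.
\<close>

section \<open>Percolation and closed sets\<close>

definition infection_closed :: "nat \<Rightarrow> 'a set \<Rightarrow> ('a \<Rightarrow> 'a \<Rightarrow> bool) \<Rightarrow> 'a set \<Rightarrow> bool" where
  "infection_closed r V E I \<longleftrightarrow> (\<forall>v\<in>V. r \<le> card (neighbours V E v \<inter> I) \<longrightarrow> v \<in> I)"

lemma finite_neighbours: "finite V \<Longrightarrow> finite (neighbours V E v)"
  by (simp add: neighbours_def)

lemma infected_mono: "s \<le> t \<Longrightarrow> infected r V E A s \<subseteq> infected r V E A t"
  by (rule lift_Suc_mono_le) auto

lemma infected_subset: "A \<subseteq> V \<Longrightarrow> infected r V E A t \<subseteq> V"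
  by (induction t) auto

lemma finite_subset_infected:
  assumes "finite N" and "N \<subseteq> (\<Union>t. infected r V E A t)"
  obtains t where "N \<subseteq> infected r V E A t"
proof -
  have "\<exists>t. N \<subseteq> infected r V E A t" using assms
  proof (induction N)
    case (insert u N)
    then obtain s t where "u \<in> infected r V E A s" "N \<subseteq> infected r V E A t" by blast
    then have "insert u N \<subseteq> infected r V E A (max s t)"
      using infected_mono[of s "max s t" r V E A] infected_mono[of t "max s t" r V E A] by auto
    then show ?case ..
  qed simp
  then show ?thesis using that by blast
qed

lemma infection_closed_infected:
  assumes "finite V"
  shows "infection_closed r V E (\<Union>t. infected r V E A t)"
  unfolding infection_closed_def
proof (intro ballI impI)
  fix v
  let ?N = "neighbours V E v \<inter> (\<Union>t. infected r V E A t)"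
  assume "v \<in> V" "r \<le> card ?N"
  have "finite ?N" by (simp add: assms finite_neighbours)
  then obtain t where "?N \<subseteq> infected r V E A t"
    by (rule finite_subset_infected) blast
  then have "?N \<subseteq> neighbours V E v \<inter> infected r V E A t" by blast
  then have "r \<le> card (neighbours V E v \<inter> infected r V E A t)"
    using \<open>r \<le> card ?N\<close> assms by (meson card_mono finite_Int finite_neighbours le_trans)
  then have "v \<in> infected r V E A (Suc t)" using \<open>v \<in> V\<close> by simp
  then show "v \<in> (\<Union>t. infected r V E A t)" by blast
qed

lemma percolates_imp_subset_closed:
  assumes "percolates r W E A" and "finite V" and "W \<subseteq> V"
    and "infection_closed r V E I" and "A \<subseteq> I"
  shows "W \<subseteq> I"
proof -
  have "infected r W E A t \<subseteq> I" for t
  proof (induction t)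
    case (Suc t)
    have "v \<in> I" if "v \<in> W" "r \<le> card (neighbours W E v \<inter> infected r W E A t)" for v
    proof -
      have "neighbours W E v \<inter> infected r W E A t \<subseteq> neighbours V E v \<inter> I"
        using Suc assms(3) by (auto simp: neighbours_def)
      then have "r \<le> card (neighbours V E v \<inter> I)"
        using that(2) assms(2) by (meson card_mono finite_Int finite_neighbours le_trans)
      then show ?thesis using assms(3,4) that(1) by (auto simp: infection_closed_def)
    qed
    then show ?case using Suc by auto
  qed (use assms(5) in simp)
  then have "(\<Union>t. infected r W E A t) \<subseteq> I" by (rule UN_least)
  then show ?thesis using assms(1) by (simp add: percolates_def)
qed

lemma percolatesI:
  assumes "finite V" and "A \<subseteq> V"
    and "\<And>I. infection_closed r V E I \<Longrightarrow> I \<subseteq> V \<Longrightarrow> A \<subseteq> I \<Longrightarrow> V \<subseteq> I"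
  shows "percolates r V E A"
proof -
  define I where "I = (\<Union>t. infected r V E A t)"
  have "A \<subseteq> I" unfolding I_def using infected.simps(1)[of r V E A] by blast
  moreover have sub: "I \<subseteq> V" unfolding I_def using infected_subset[OF assms(2)] by (rule UN_least)
  moreover have "infection_closed r V E I"
    unfolding I_def using assms(1) by (rule infection_closed_infected)
  ultimately have "V \<subseteq> I" by (intro assms(3))
  with sub have "I = V" by (rule equalityI)
  then show ?thesis using assms(2) by (simp add: percolates_def I_def)
qed

lemma percolates_superset:
  assumes "percolates r V E A" and "finite V" and "A \<subseteq> B" and "B \<subseteq> V"
  shows "percolates r V E B"
proof (rule percolatesI[OF assms(2,4)])
  fix I assume "infection_closed r V E I" "I \<subseteq> V" "B \<subseteq> I"
  then show "V \<subseteq> I" using percolates_imp_subset_closed[OF assms(1,2)] assms(3) by blast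
qed

lemma infected_image:
  assumes "inj f" and "\<And>u v. E (f u) (f v) \<longleftrightarrow> E u v"
  shows "infected r (f ` V) E (f ` A) t = f ` infected r V E A t"
proof (induction t)
  case (Suc t)
  have "neighbours (f ` V) E (f v) \<inter> f ` infected r V E A t =
      f ` (neighbours V E v \<inter> infected r V E A t)"
    for v using assms by (auto simp: neighbours_def image_Int inj_eq)
  then have "card (neighbours (f ` V) E (f v) \<inter> f ` infected r V E A t) =
      card (neighbours V E v \<inter> infected r V E A t)" for v
    by (metis assms(1) card_image inj_on_subset subset_UNIV)
  then show ?case using Suc by auto
qed simp

lemma percolates_image:
  assumes "inj f" and "\<And>u v. E (f u) (f v) \<longleftrightarrow> E u v" and "percolates r V E A"
  shows "percolates r (f ` V) E (f ` A)"
  using assms(3) unfolding percolates_def infected_image[of f E, OF assms(1,2)] by blast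

section \<open>Perfect grids\<close>

lemma finite_grid_verts: "finite (grid_verts a b c)"
  by (simp add: grid_verts_def)

lemma card_grid_verts: "card (grid_verts a b c) = a * b * c"
  by (simp add: grid_verts_def)

lemma perfect_grid_if_card_le:
  assumes pos: "0 < a" "0 < b" "0 < c" and dvd: "3 dvd a * b + a * c + b * c"
    and A: "percolates 3 (grid_verts a b c) grid_adj A" "3 * card A \<le> a * b + a * c + b * c"
  shows "perfect_grid a b c"
proof -
  let ?V = "grid_verts a b c" and ?k = "(a * b + a * c + b * c) div 3"
  have "a * b \<le> a * b * c" "a * c \<le> a * b * c" "b * c \<le> a * b * c" using pos by simp_all
  then have "?k \<le> card ?V" unfolding card_grid_verts by linarith
  moreover have "card A \<le> ?k" using A(2) by simp
  moreover have "A \<subseteq> ?V" using A(1) by (simp add: percolates_def)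
  ultimately obtain B where "A \<subseteq> B" "B \<subseteq> ?V" "card B = ?k"
    using exists_subset_between[of A ?k ?V] finite_grid_verts by blast
  then show ?thesis
    using percolates_superset[OF A(1) finite_grid_verts] dvd by (auto simp: perfect_grid_def)
qed

lemma perfect_grid_swap:
  assumes "perfect_grid a b c"
  shows "perfect_grid a c b"
proof -
  define f :: "vertex3 \<Rightarrow> vertex3" where "f = (\<lambda>(x, y, z). (x, z, y))"
  have inj: "inj f" by (auto simp: f_def inj_def)
  have adj: "grid_adj (f u) (f v) \<longleftrightarrow> grid_adj u v" for u v
    by (cases u; cases v) (auto simp: f_def)
  have verts: "f ` grid_verts a b c = grid_verts a c b"
    by (force simp: f_def grid_verts_def)
  obtain A where A: "percolates 3 (grid_verts a b c) grid_adj A"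
    "card A = (a * b + a * c + b * c) div 3"
    using assms by (auto simp: perfect_grid_def)
  have "percolates 3 (grid_verts a c b) grid_adj (f ` A)"
    using percolates_image[of f grid_adj, OF inj adj A(1)] verts by simp
  moreover have "card (f ` A) = (a * c + a * b + c * b) div 3"
    using A(2) inj by (simp add: card_image inj_on_subset[OF inj] algebra_simps)
  ultimately show ?thesis
    using assms by (auto simp: perfect_grid_def algebra_simps)
qed

fun translate :: "vertex3 \<Rightarrow> vertex3 \<Rightarrow> vertex3" where
  "translate (i, j, k) (x, y, z) = (i + x, j + y, k + z)"

definition brick :: "vertex3 \<Rightarrow> nat \<Rightarrow> nat \<Rightarrow> nat \<Rightarrow> vertex3 set" where
  "brick p a b c = translate p ` grid_verts a b c"

lemma inj_translate: "inj (translate p)"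
  by (cases p) (auto simp: inj_def)

lemma grid_adj_translate: "grid_adj (translate p u) (translate p v) \<longleftrightarrow> grid_adj u v"
  by (cases p; cases u; cases v) (auto simp: path_adj_def)

lemma mem_brick_iff:
  "(x, y, z) \<in> brick (i, j, k) a b c \<longleftrightarrow>
    i < x \<and> x \<le> i + a \<and> j < y \<and> y \<le> j + b \<and> k < z \<and> z \<le> k + c"
proof
  assume "i < x \<and> x \<le> i + a \<and> j < y \<and> y \<le> j + b \<and> k < z \<and> z \<le> k + c"
  then have "(x, y, z) = translate (i, j, k) (x - i, y - j, z - k)"
    "(x - i, y - j, z - k) \<in> grid_verts a b c"
    by (auto simp: grid_verts_def)
  then show "(x, y, z) \<in> brick (i, j, k) a b c" unfolding brick_def by blast
qed (auto simp: brick_def grid_verts_def)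

lemma perfect_brickE:
  assumes "perfect_grid a b c"
  obtains A where "percolates 3 (brick p a b c) grid_adj A" and "3 * card A = a * b + a * c + b * c"
proof -
  obtain A where A: "percolates 3 (grid_verts a b c) grid_adj A" "3 * card A = a * b + a * c + b * c"
    using assms by (auto simp: perfect_grid_def)
  show ?thesis
  proof (rule that)
    show "percolates 3 (brick p a b c) grid_adj (translate p ` A)"
      using percolates_image[of "translate p" grid_adj, OF inj_translate grid_adj_translate A(1)]
      unfolding brick_def .
    show "3 * card (translate p ` A) = a * b + a * c + b * c"
      using A(2) by (simp add: card_image inj_on_subset[OF inj_translate])
  qed
qed

section \<open>Closed sets of a grid\<close>

lemma neighbour_outside_grid:
  assumes "(x, y, z) \<notin> grid_verts a b c" and "grid_adj (x, y, z) u" and "u \<in> grid_verts a b c"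
  shows "u = (max 1 (min a x), max 1 (min b y), max 1 (min c z))"
  using assms
  by (cases u) (auto simp: grid_verts_def path_adj_def max_def min_def split: if_splits)

locale closed_grid_set =
  fixes a b c :: nat and I :: "vertex3 set"
  assumes subset: "I \<subseteq> grid_verts a b c"
    and closed: "infection_closed 3 (grid_verts a b c) grid_adj I"
begin

lemma mem_if_three_neighbours:
  assumes N: "N \<subseteq> I" "\<And>u. u \<in> N \<Longrightarrow> grid_adj v u" "3 \<le> card N"
  shows "v \<in> I"
proof -
  have "v \<in> grid_verts a b c"
  proof (rule ccontr)
    assume outside: "v \<notin> grid_verts a b c"
    obtain x y z where v: "v = (x, y, z)" by (cases v)
    have "u = (max 1 (min a x), max 1 (min b y), max 1 (min c z))" if "u \<in> N" for u
      using outside N(1,2) that subset unfolding v by (intro neighbour_outside_grid) auto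
    then have "card N \<le> card {(max 1 (min a x), max 1 (min b y), max 1 (min c z))}"
      by (intro card_mono) auto
    then show False using N(3) by simp
  qed
  moreover have "N \<subseteq> neighbours (grid_verts a b c) grid_adj v \<inter> I"
    using N(1,2) subset by (auto simp: neighbours_def)
  then have "3 \<le> card (neighbours (grid_verts a b c) grid_adj v \<inter> I)"
    using N(3) by (meson card_mono finite_Int finite_grid_verts finite_neighbours le_trans)
  ultimately show ?thesis using closed by (simp add: infection_closed_def)
qed

lemma subset_if_percolates:
  assumes "percolates 3 W grid_adj A" and "W \<subseteq> grid_verts a b c" and "A \<subseteq> I"
  shows "W \<subseteq> I"
  using percolates_imp_subset_closed[OF assms(1) finite_grid_verts assms(2) closed assms(3)] .

end

section \<open>Gluing four perfect grids\<close>

definition toward :: "nat \<Rightarrow> nat \<Rightarrow> nat" where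
  "toward k i = (if i \<le> k then i + 1 else i - 1)"

definition face_dist :: "nat \<Rightarrow> nat \<Rightarrow> nat" where
  "face_dist k i = (if i \<le> k then k - i else i - k - 1)"

lemma toward_cases:
  "face_dist k (toward k i) < face_dist k i \<and> (toward k i \<le> k \<longleftrightarrow> i \<le> k) \<or>
   (toward k i \<le> k \<longleftrightarrow> \<not> i \<le> k)"
  by (auto simp: toward_def face_dist_def)

lemma path_adj_toward: "0 < i \<Longrightarrow> path_adj i (toward k i)"
  by (auto simp: toward_def path_adj_def)

lemma toward_bounds: "i \<in> {1..k + l} \<Longrightarrow> 0 < k \<Longrightarrow> 0 < l \<Longrightarrow> toward k i \<in> {1..k + l}"
  by (auto simp: toward_def)

lemma octants_fill:
  assumes I: "closed_grid_set (a + a') (b + b') (c + c') I"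
    and pos: "0 < a" "0 < a'" "0 < b" "0 < b'" "0 < c" "0 < c'"
    and alternate: "\<And>x y z. (x, y, z) \<in> grid_verts (a + a') (b + b') (c + c') \<Longrightarrow>
      (x \<le> a \<longleftrightarrow> (y \<le> b \<longleftrightarrow> z \<le> c)) \<Longrightarrow> (x, y, z) \<in> I"
    and v: "(x, y, z) \<in> grid_verts (a + a') (b + b') (c + c')"
  shows "(x, y, z) \<in> I"
  using v
proof (induction "face_dist a x + face_dist b y + face_dist c z" arbitrary: x y z rule: less_induct)
  case less
  show ?case
  proof (cases "x \<le> a \<longleftrightarrow> (y \<le> b \<longleftrightarrow> z \<le> c)")
    case True
    then show ?thesis using alternate less.prems by blast
  next
    case False
    let ?x = "toward a x" and ?y = "toward b y" and ?z = "toward c z"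
    let ?N = "{(?x, y, z), (x, ?y, z), (x, y, ?z)}"
    have xyz: "x \<in> {1..a + a'}" "y \<in> {1..b + b'}" "z \<in> {1..c + c'}"
      using less.prems by (auto simp: grid_verts_def)
    note bounds = xyz toward_bounds[OF xyz(1) pos(1,2)] toward_bounds[OF xyz(2) pos(3,4)]
      toward_bounds[OF xyz(3) pos(5,6)]
    have "(?x, y, z) \<in> I"
      using toward_cases[of a x] False bounds less.hyps[of ?x y z] alternate[of ?x y z]
      by (auto simp: grid_verts_def)
    moreover have "(x, ?y, z) \<in> I"
      using toward_cases[of b y] False bounds less.hyps[of x ?y z] alternate[of x ?y z]
      by (auto simp: grid_verts_def)
    moreover have "(x, y, ?z) \<in> I"
      using toward_cases[of c z] False bounds less.hyps[of x y ?z] alternate[of x y ?z]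
      by (auto simp: grid_verts_def)
    moreover have adj: "path_adj x ?x" "path_adj y ?y" "path_adj z ?z"
      using xyz by (auto intro: path_adj_toward)
    moreover from adj have "card ?N = 3" by (auto simp: path_adj_def)
    ultimately show ?thesis
      by (intro closed_grid_set.mem_if_three_neighbours[OF I, of ?N]) auto
  qed
qed

lemma percolates_octants:
  fixes a a' b b' c c' :: nat
  defines "V \<equiv> grid_verts (a + a') (b + b') (c + c')"
  assumes pos: "0 < a" "0 < a'" "0 < b" "0 < b'" "0 < c" "0 < c'"
    and lll: "percolates 3 (brick (0, 0, 0) a b c) grid_adj lll"
    and lhh: "percolates 3 (brick (0, b, c) a b' c') grid_adj lhh"
    and hlh: "percolates 3 (brick (a, 0, c) a' b c') grid_adj hlh"
    and hhl: "percolates 3 (brick (a, b, 0) a' b' c) grid_adj hhl"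
  shows "percolates 3 V grid_adj (lll \<union> lhh \<union> hlh \<union> hhl)"
proof (rule percolatesI)
  show "finite V" unfolding V_def by (rule finite_grid_verts)
  have bricks: "brick (0, 0, 0) a b c \<subseteq> V" "brick (0, b, c) a b' c' \<subseteq> V"
      "brick (a, 0, c) a' b c' \<subseteq> V" "brick (a, b, 0) a' b' c \<subseteq> V"
    by (auto simp: V_def mem_brick_iff grid_verts_def)
  have "lll \<subseteq> brick (0, 0, 0) a b c" "lhh \<subseteq> brick (0, b, c) a b' c'"
      "hlh \<subseteq> brick (a, 0, c) a' b c'" "hhl \<subseteq> brick (a, b, 0) a' b' c"
    using lll lhh hlh hhl by (simp_all add: percolates_def)
  then show "lll \<union> lhh \<union> hlh \<union> hhl \<subseteq> V"
    using bricks by (intro Un_least) (blast intro: subset_trans)+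
  fix I assume I: "infection_closed 3 V grid_adj I" "I \<subseteq> V" "lll \<union> lhh \<union> hlh \<union> hhl \<subseteq> I"
  interpret closed_grid_set "a + a'" "b + b'" "c + c'" I
    using I(1,2) by unfold_locales (simp_all add: V_def)
  have infected: "brick (0, 0, 0) a b c \<subseteq> I" "brick (0, b, c) a b' c' \<subseteq> I"
      "brick (a, 0, c) a' b c' \<subseteq> I" "brick (a, b, 0) a' b' c \<subseteq> I"
    using subset_if_percolates[OF lll] subset_if_percolates[OF lhh] subset_if_percolates[OF hlh]
      subset_if_percolates[OF hhl] bricks I(3) by (simp_all add: V_def)
  have "(x, y, z) \<in> I" if "(x, y, z) \<in> V" "x \<le> a \<longleftrightarrow> (y \<le> b \<longleftrightarrow> z \<le> c)" for x y z
  proof -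
    have "(x, y, z) \<in> brick (0, 0, 0) a b c \<union> brick (0, b, c) a b' c' \<union>
        brick (a, 0, c) a' b c' \<union> brick (a, b, 0) a' b' c"
      using that by (auto simp: V_def grid_verts_def mem_brick_iff)
    then show ?thesis using infected by (elim UnE) (simp_all add: subset_iff)
  qed
  then show "V \<subseteq> I"
    unfolding V_def by (auto intro: octants_fill[OF closed_grid_set_axioms pos])
qed

lemma perfect_grid_octants:
  assumes pos: "0 < a" "0 < a'" "0 < b" "0 < b'" "0 < c" "0 < c'"
    and perfect: "perfect_grid a b c" "perfect_grid a b' c'"
      "perfect_grid a' b c'" "perfect_grid a' b' c"
  shows "perfect_grid (a + a') (b + b') (c + c')"
proof -
  obtain lll where lll: "percolates 3 (brick (0, 0, 0) a b c) grid_adj lll"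
      "3 * card lll = a * b + a * c + b * c"
    by (rule perfect_brickE[OF perfect(1)])
  obtain lhh where lhh: "percolates 3 (brick (0, b, c) a b' c') grid_adj lhh"
      "3 * card lhh = a * b' + a * c' + b' * c'"
    by (rule perfect_brickE[OF perfect(2)])
  obtain hlh where hlh: "percolates 3 (brick (a, 0, c) a' b c') grid_adj hlh"
      "3 * card hlh = a' * b + a' * c' + b * c'"
    by (rule perfect_brickE[OF perfect(3)])
  obtain hhl where hhl: "percolates 3 (brick (a, b, 0) a' b' c) grid_adj hhl"
      "3 * card hhl = a' * b' + a' * c + b' * c"
    by (rule perfect_brickE[OF perfect(4)])
  let ?total = "(a + a') * (b + b') + (a + a') * (c + c') + (b + b') * (c + c')"
  have total: "3 * card lll + 3 * card lhh + 3 * card hlh + 3 * card hhl = ?total"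
    unfolding lll(2) lhh(2) hlh(2) hhl(2) by (simp add: algebra_simps)
  have "card (lll \<union> lhh \<union> hlh \<union> hhl) \<le> card lll + card lhh + card hlh + card hhl"
    by (meson card_Un_le add_le_mono le_trans order_refl)
  then have "3 * card (lll \<union> lhh \<union> hlh \<union> hhl) \<le> ?total"
    unfolding total[symmetric] by linarith
  moreover have "3 dvd ?total" unfolding total[symmetric] by simp
  ultimately show ?thesis
    using percolates_octants[OF pos lll(1) lhh(1) hlh(1) hhl(1)] pos
    by (intro perfect_grid_if_card_le) simp_all
qed

section \<open>Pictures of sets of vertices\<close>

text \<open>A row runs along the \<open>z\<close>-axis, a slice lists rows along the \<open>x\<close>-axis, a picture lists slices along
  the \<open>y\<close>-axis.\<close>

type_synonym row = "bool list"
type_synonym slice = "row list"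
type_synonym picture = "slice list"

fun row_cells :: "nat \<Rightarrow> nat \<Rightarrow> nat \<Rightarrow> row \<Rightarrow> vertex3 set" where
  "row_cells x y z [] = {}"
| "row_cells x y z (q # qs) = (if q then {(x, y, z)} else {}) \<union> row_cells x y (Suc z) qs"

fun slice_cells :: "nat \<Rightarrow> nat \<Rightarrow> nat \<Rightarrow> slice \<Rightarrow> vertex3 set" where
  "slice_cells x y z [] = {}"
| "slice_cells x y z (r # rs) = row_cells x y z r \<union> slice_cells (Suc x) y z rs"

fun picture_cells :: "nat \<Rightarrow> nat \<Rightarrow> picture \<Rightarrow> vertex3 set" where
  "picture_cells y z [] = {}"
| "picture_cells y z (s # ss) = slice_cells 1 y z s \<union> picture_cells (Suc y) z ss"

text \<open>
  The vertex \<open>q\<close> has the neighbours \<open>l\<close>, \<open>r\<close> on the \<open>z\<close>-axis, \<open>u\<close>, \<open>d\<close> on the \<open>y\<close>-axis and \<open>f\<close>, \<open>g\<close> on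
  the \<open>x\<close>-axis. The functions below pass through a picture once; every entry is updated on the way
  out and again on the way back. Results that are used twice are passed to auxiliary functions
  rather than bound by \<open>let\<close>, because the simplifier would evaluate the body of a \<open>let\<close> symbolically.
\<close>

fun head :: "'a \<Rightarrow> 'a list \<Rightarrow> 'a" where
  "head d [] = d"
| "head d (x # xs) = x"

definition infect :: "bool \<Rightarrow> bool \<Rightarrow> bool \<Rightarrow> bool \<Rightarrow> bool \<Rightarrow> bool \<Rightarrow> bool \<Rightarrow> bool" where
  "infect q l r u d f g \<longleftrightarrow> q \<or> 3 \<le> count_list [l, r, u, d, f, g] True"

definition infect_head :: "bool \<Rightarrow> row \<Rightarrow> row \<Rightarrow> row \<Rightarrow> row \<Rightarrow> bool \<Rightarrow> row \<Rightarrow> row" where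
  "infect_head l us ds fs gs q qs =
     infect q l (head False qs) (head False us) (head False ds) (head False fs) (head False gs) # qs"

fun spread_row :: "bool \<Rightarrow> row \<Rightarrow> row \<Rightarrow> row \<Rightarrow> row \<Rightarrow> row \<Rightarrow> row" where
  "spread_row l us ds fs gs [] = []"
| "spread_row l us ds fs gs (q # qs) = infect_head l us ds fs gs q
     (spread_row
       (infect q l (head False qs) (head False us) (head False ds) (head False fs) (head False gs))
       (tl us) (tl ds) (tl fs) (tl gs) qs)"

definition spread_head_row :: "row \<Rightarrow> slice \<Rightarrow> slice \<Rightarrow> row \<Rightarrow> slice \<Rightarrow> slice" where
  "spread_head_row f us ds r rs = spread_row False (head [] us) (head [] ds) f (head [] rs) r # rs"

fun spread_slice :: "row \<Rightarrow> slice \<Rightarrow> slice \<Rightarrow> slice \<Rightarrow> slice" where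
  "spread_slice f us ds [] = []"
| "spread_slice f us ds (r # rs) = spread_head_row f us ds r
     (spread_slice (spread_row False (head [] us) (head [] ds) f (head [] rs) r) (tl us) (tl ds) rs)"

definition spread_head_slice :: "slice \<Rightarrow> slice \<Rightarrow> picture \<Rightarrow> picture" where
  "spread_head_slice u s ss = spread_slice [] u (head [] ss) s # ss"

fun spread_picture :: "slice \<Rightarrow> picture \<Rightarrow> picture" where
  "spread_picture u [] = []"
| "spread_picture u (s # ss) =
     spread_head_slice u s (spread_picture (spread_slice [] u (head [] ss) s) ss)"

fun spread :: "nat \<Rightarrow> picture \<Rightarrow> picture" where
  "spread 0 P = P"
| "spread (Suc n) P = spread n (spread_picture [] P)"

lemma row_cells_head: "row_cells x y z qs \<subseteq> I \<Longrightarrow> head False qs \<Longrightarrow> (x, y, z) \<in> I"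
  by (cases qs) auto

lemma row_cells_tl: "row_cells x y z qs \<subseteq> I \<Longrightarrow> row_cells x y (Suc z) (tl qs) \<subseteq> I"
  by (cases qs) auto

lemma slice_cells_head: "slice_cells x y z rs \<subseteq> I \<Longrightarrow> row_cells x y z (head [] rs) \<subseteq> I"
  by (cases rs) auto

lemma slice_cells_tl: "slice_cells x y z rs \<subseteq> I \<Longrightarrow> slice_cells (Suc x) y z (tl rs) \<subseteq> I"
  by (cases rs) auto

lemma picture_cells_head: "picture_cells y z ss \<subseteq> I \<Longrightarrow> slice_cells 1 y z (head [] ss) \<subseteq> I"
  by (cases ss) auto

lemma card_zip_True:
  assumes "distinct us" and "length us = length bs"
  shows "card {u. (u, True) \<in> set (zip us bs)} = count_list bs True"
  using assms(2,1)
proof (induction us bs rule: list_induct2)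
  case (Cons u us b bs)
  have "{v. (v, True) \<in> set (zip (u # us) (b # bs))} =
      (if b then {u} else {}) \<union> {v. (v, True) \<in> set (zip us bs)}" by auto
  moreover have "u \<notin> {v. (v, True) \<in> set (zip us bs)}"
    using Cons.prems by (auto dest: set_zip_leftD)
  moreover have "finite {v. (v, True) \<in> set (zip us bs)}"
    by (rule finite_subset[of _ "set us"]) (auto dest: set_zip_leftD)
  ultimately show ?case using Cons by simp
qed simp

context closed_grid_set
begin

lemma infect_sound:
  assumes "infect q l r u d f g"
    and "q \<Longrightarrow> (Suc x, Suc y, Suc z) \<in> I"
    and "l \<Longrightarrow> (Suc x, Suc y, z) \<in> I" "r \<Longrightarrow> (Suc x, Suc y, Suc (Suc z)) \<in> I"
    and "u \<Longrightarrow> (Suc x, y, Suc z) \<in> I" "d \<Longrightarrow> (Suc x, Suc (Suc y), Suc z) \<in> I"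
    and "f \<Longrightarrow> (x, Suc y, Suc z) \<in> I" "g \<Longrightarrow> (Suc (Suc x), Suc y, Suc z) \<in> I"
  shows "(Suc x, Suc y, Suc z) \<in> I"
proof (cases q)
  case False
  define us where "us = [(Suc x, Suc y, z), (Suc x, Suc y, Suc (Suc z)), (Suc x, y, Suc z),
    (Suc x, Suc (Suc y), Suc z), (x, Suc y, Suc z), (Suc (Suc x), Suc y, Suc z)]"
  let ?N = "{v. (v, True) \<in> set (zip us [l, r, u, d, f, g])}"
  have "distinct us" "length us = length [l, r, u, d, f, g]" by (simp_all add: us_def)
  then have "card ?N = count_list [l, r, u, d, f, g] True" by (rule card_zip_True)
  then have "3 \<le> card ?N" using assms(1) False by (simp only: infect_def simp_thms)
  moreover have "?N \<subseteq> I" using assms(3-) by (auto simp: us_def)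
  moreover have "grid_adj (Suc x, Suc y, Suc z) v" if "v \<in> ?N" for v
    using that by (auto simp: us_def path_adj_def)
  ultimately show ?thesis by (intro mem_if_three_neighbours[of ?N])
qed (use assms(2) in simp)

lemma spread_row_sound:
  assumes "l \<Longrightarrow> (Suc x, Suc y, z) \<in> I"
    and "row_cells (Suc x) y (Suc z) us \<subseteq> I" and "row_cells (Suc x) (Suc (Suc y)) (Suc z) ds \<subseteq> I"
    and "row_cells x (Suc y) (Suc z) fs \<subseteq> I" and "row_cells (Suc (Suc x)) (Suc y) (Suc z) gs \<subseteq> I"
    and "row_cells (Suc x) (Suc y) (Suc z) qs \<subseteq> I"
  shows "row_cells (Suc x) (Suc y) (Suc z) (spread_row l us ds fs gs qs) \<subseteq> I"
  using assms
proof (induction qs arbitrary: z l us ds fs gs)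
  case (Cons q qs)
  let ?infect = "\<lambda>r. infect q l r (head False us) (head False ds) (head False fs) (head False gs)"
  have infect: "(Suc x, Suc y, Suc z) \<in> I"
    if "?infect r" "r \<Longrightarrow> (Suc x, Suc y, Suc (Suc z)) \<in> I" for r
    by (rule infect_sound[OF that(1) _ Cons.prems(1) that(2)])
      (use Cons.prems(6) in simp, use Cons.prems(2-5) in \<open>simp_all add: row_cells_head\<close>)
  have qs: "row_cells (Suc x) (Suc y) (Suc (Suc z)) qs \<subseteq> I" using Cons.prems(6) by simp
  let ?qs' = "spread_row (?infect (head False qs)) (tl us) (tl ds) (tl fs) (tl gs) qs"
  have "row_cells (Suc x) (Suc y) (Suc (Suc z)) ?qs' \<subseteq> I"
  proof (rule Cons.IH)
    show "(Suc x, Suc y, Suc z) \<in> I" if "?infect (head False qs)"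
      using that qs by (intro infect[of "head False qs"]) (simp_all add: row_cells_head)
  qed (use qs Cons.prems(2-5) in \<open>simp_all add: row_cells_tl\<close>)
  moreover from this have "(Suc x, Suc y, Suc z) \<in> I" if "?infect (head False ?qs')"
    using that by (intro infect[of "head False ?qs'"]) (simp_all add: row_cells_head)
  ultimately show ?case by (simp add: infect_head_def)
qed simp

lemma spread_slice_sound:
  assumes "row_cells x (Suc y) (Suc z) f \<subseteq> I"
    and "slice_cells (Suc x) y (Suc z) us \<subseteq> I" and "slice_cells (Suc x) (Suc (Suc y)) (Suc z) ds \<subseteq> I"
    and "slice_cells (Suc x) (Suc y) (Suc z) rs \<subseteq> I"
  shows "slice_cells (Suc x) (Suc y) (Suc z) (spread_slice f us ds rs) \<subseteq> I"
  using assms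
proof (induction rs arbitrary: x f us ds)
  case (Cons r rs)
  have row: "row_cells (Suc x) (Suc y) (Suc z) (spread_row False (head [] us) (head [] ds) f g r) \<subseteq> I"
    if "row_cells (Suc (Suc x)) (Suc y) (Suc z) g \<subseteq> I" for g
    using that Cons.prems by (intro spread_row_sound) (simp_all add: slice_cells_head)
  have rs: "slice_cells (Suc (Suc x)) (Suc y) (Suc z) rs \<subseteq> I" using Cons.prems(4) by simp
  let ?rs' = "spread_slice (spread_row False (head [] us) (head [] ds) f (head [] rs) r)
    (tl us) (tl ds) rs"
  have "slice_cells (Suc (Suc x)) (Suc y) (Suc z) ?rs' \<subseteq> I"
    by (rule Cons.IH[OF row]) (use rs Cons.prems(2,3) in \<open>simp_all add: slice_cells_head slice_cells_tl\<close>)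
  moreover from this have "row_cells (Suc x) (Suc y) (Suc z)
      (spread_row False (head [] us) (head [] ds) f (head [] ?rs') r) \<subseteq> I"
    by (intro row slice_cells_head)
  ultimately show ?case by (simp add: spread_head_row_def)
qed simp

lemma spread_picture_sound:
  assumes "slice_cells 1 y (Suc z) u \<subseteq> I" and "picture_cells (Suc y) (Suc z) ss \<subseteq> I"
  shows "picture_cells (Suc y) (Suc z) (spread_picture u ss) \<subseteq> I"
  using assms
proof (induction ss arbitrary: y u)
  case (Cons s ss)
  have slice: "slice_cells 1 (Suc y) (Suc z) (spread_slice [] u d s) \<subseteq> I"
    if "slice_cells 1 (Suc (Suc y)) (Suc z) d \<subseteq> I" for d
    using spread_slice_sound[of 0 y z "[]" u d s] that Cons.prems by simp
  have ss: "picture_cells (Suc (Suc y)) (Suc z) ss \<subseteq> I" using Cons.prems(2) by simp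
  let ?ss' = "spread_picture (spread_slice [] u (head [] ss) s) ss"
  have "picture_cells (Suc (Suc y)) (Suc z) ?ss' \<subseteq> I"
    by (rule Cons.IH[OF slice ss]) (rule picture_cells_head[OF ss])
  moreover from this have "slice_cells 1 (Suc y) (Suc z) (spread_slice [] u (head [] ?ss') s) \<subseteq> I"
    by (intro slice picture_cells_head)
  ultimately show ?case by (simp add: spread_head_slice_def)
qed simp

lemma spread_sound:
  "picture_cells (Suc y) (Suc z) P \<subseteq> I \<Longrightarrow> picture_cells (Suc y) (Suc z) (spread n P) \<subseteq> I"
  by (induction n P rule: spread.induct) (simp_all add: spread_picture_sound)

end

section \<open>Sweeping a strip\<close>

text \<open>
  A strip \<open>(T, M, B)\<close> consists of the slices \<open>T\<close>, of any number of copies of \<open>M\<close>, and of the slices \<open>B\<close>.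
  The sweep \<open>Up e\<close> starts in \<open>B\<close> and runs through the copies of \<open>M\<close> to \<open>T\<close>: it is confirmed if the
  slice \<open>e\<close> becomes infected at the head of \<open>B\<close> and, provided that it is infected just below a copy
  of \<open>M\<close>, also at the head of this copy. What lies above a block is either \<open>T\<close> or a copy of \<open>M\<close>, so
  only the common part of their last slices is used. \<open>Down d\<close> is the same in the other direction.
\<close>

type_synonym strip = "picture \<times> picture \<times> picture"

fun stack :: "nat \<Rightarrow> strip \<Rightarrow> picture" where
  "stack m (T, M, B) = T @ concat (replicate m M) @ B"

definition foot :: "picture \<Rightarrow> slice" where
  "foot P = head [] (rev P)"

definition common :: "slice \<Rightarrow> slice \<Rightarrow> slice" where
  "common = map2 (map2 (\<and>))"

definition contained :: "slice \<Rightarrow> slice \<Rightarrow> bool" where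
  "contained = list_all2 (list_all2 (\<longrightarrow>))"

fun relax :: "nat \<Rightarrow> slice \<Rightarrow> slice \<Rightarrow> strip \<Rightarrow> strip" where
  "relax n d e (T, M, B) =
     (butlast (spread n (T @ [e])), tl (butlast (spread n (d # M @ [e]))), tl (spread n (d # B)))"

datatype sweep = Up slice | Down slice

fun run_sweep :: "nat \<Rightarrow> sweep \<Rightarrow> strip \<Rightarrow> strip" where
  "run_sweep n (Up e) (T, M, B) = relax n (common (foot T) (foot M)) e (T, M, B)"
| "run_sweep n (Down d) (T, M, B) = relax n d (common (head [] M) (head [] B)) (T, M, B)"

fun confirms :: "strip \<Rightarrow> sweep \<Rightarrow> bool" where
  "confirms (T, M, B) (Up e) \<longleftrightarrow> contained e (head [] M) \<and> contained e (head [] B)"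
| "confirms (T, M, B) (Down d) \<longleftrightarrow> contained d (foot T) \<and> contained d (foot M)"

lemma picture_cells_append:
  "picture_cells y z (P @ Q) = picture_cells y z P \<union> picture_cells (y + length P) z Q"
  by (induction P arbitrary: y) auto

lemma picture_cells_replicate:
  "picture_cells y z (concat (replicate m M)) \<subseteq> I \<longleftrightarrow> (\<forall>i<m. picture_cells (y + i * length M) z M \<subseteq> I)"
proof (induction m arbitrary: y)
  case (Suc m)
  have "(\<forall>i<Suc m. picture_cells (y + i * length M) z M \<subseteq> I) \<longleftrightarrow>
      picture_cells y z M \<subseteq> I \<and> (\<forall>i<m. picture_cells (y + length M + i * length M) z M \<subseteq> I)"
    unfolding All_less_Suc2 by (simp add: add.assoc)
  then show ?case using Suc by (simp add: picture_cells_append)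
qed simp

lemma picture_cells_stack:
  "picture_cells 1 z (stack m (T, M, B)) \<subseteq> I \<longleftrightarrow> picture_cells 1 z T \<subseteq> I \<and>
     (\<forall>i<m. picture_cells (Suc (length T + i * length M)) z M \<subseteq> I) \<and>
     picture_cells (Suc (length T + m * length M)) z B \<subseteq> I"
  by (simp add: picture_cells_append picture_cells_replicate length_concat sum_list_replicate)

lemma picture_cells_tl: "picture_cells y z P \<subseteq> I \<Longrightarrow> picture_cells (Suc y) z (tl P) \<subseteq> I"
  by (cases P) auto

lemma picture_cells_butlast: "picture_cells y z P \<subseteq> I \<Longrightarrow> picture_cells y z (butlast P) \<subseteq> I"
  by (cases P rule: rev_cases) (auto simp: picture_cells_append)

lemma picture_cells_foot: "picture_cells (Suc y) z P \<subseteq> I \<Longrightarrow> slice_cells 1 (y + length P) z (foot P) \<subseteq> I"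
  by (cases P rule: rev_cases) (auto simp: foot_def picture_cells_append)

lemma row_cells_common:
  "row_cells x y z (map2 (\<and>) r r') \<subseteq> row_cells x y z r"
  "row_cells x y z (map2 (\<and>) r r') \<subseteq> row_cells x y z r'"
  by (induction r r' arbitrary: z rule: list_induct2') auto

lemma slice_cells_common:
  "slice_cells x y z (common s s') \<subseteq> slice_cells x y z s"
  "slice_cells x y z (common s s') \<subseteq> slice_cells x y z s'"
  unfolding common_def
  by (induction s s' arbitrary: x rule: list_induct2')
    (use row_cells_common in \<open>simp_all, blast+\<close>)

lemma row_cells_mono: "list_all2 (\<longrightarrow>) r r' \<Longrightarrow> row_cells x y z r \<subseteq> row_cells x y z r'"
  by (induction arbitrary: z rule: list_all2_induct) auto

lemma slice_cells_contained: "contained s s' \<Longrightarrow> slice_cells x y z s \<subseteq> slice_cells x y z s'"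
  unfolding contained_def
  by (induction arbitrary: x rule: list_all2_induct) (use row_cells_mono in \<open>simp_all, blast+\<close>)

lemma length_spread_picture [simp]: "length (spread_picture u P) = length P"
  by (induction u P rule: spread_picture.induct) (simp_all add: spread_head_slice_def)

lemma length_spread [simp]: "length (spread n P) = length P"
  by (induction n P rule: spread.induct) simp_all

context closed_grid_set
begin

lemma relax_top_sound:
  assumes "picture_cells 1 (Suc z) T \<subseteq> I" and "slice_cells 1 (Suc (length T)) (Suc z) e \<subseteq> I"
  shows "picture_cells 1 (Suc z) (butlast (spread n (T @ [e]))) \<subseteq> I"
  using assms spread_sound[of 0 z "T @ [e]" n] by (simp add: picture_cells_append picture_cells_butlast)

lemma relax_bottom_sound:
  assumes "0 < y" and "slice_cells 1 y (Suc z) d \<subseteq> I" and "picture_cells (Suc y) (Suc z) B \<subseteq> I"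
  shows "picture_cells (Suc y) (Suc z) (tl (spread n (d # B))) \<subseteq> I"
  using assms spread_sound[of "y - 1" z "d # B" n] by (simp add: picture_cells_tl)

lemma relax_middle_sound:
  assumes "0 < y" and "slice_cells 1 y (Suc z) d \<subseteq> I" and "picture_cells (Suc y) (Suc z) M \<subseteq> I"
    and "slice_cells 1 (Suc (y + length M)) (Suc z) e \<subseteq> I"
  shows "picture_cells (Suc y) (Suc z) (tl (butlast (spread n (d # M @ [e])))) \<subseteq> I"
  using assms spread_sound[of "y - 1" z "d # M @ [e]" n]
  by (simp add: picture_cells_append picture_cells_tl picture_cells_butlast)

context
  fixes z m n :: nat and T M B :: picture
  assumes nonempty: "T \<noteq> []" and inside: "picture_cells 1 (Suc z) (stack m (T, M, B)) \<subseteq> I"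
begin

definition joint :: "nat \<Rightarrow> nat" where
  "joint i = length T + i * length M"

lemma joint_pos: "0 < joint i"
  using nonempty by (simp add: joint_def)

lemma joint_Suc: "joint (Suc i) = joint i + length M"
  by (simp add: joint_def)

lemma block_cells:
  shows "picture_cells 1 (Suc z) T \<subseteq> I"
    and "i < m \<Longrightarrow> picture_cells (Suc (joint i)) (Suc z) M \<subseteq> I"
    and "picture_cells (Suc (joint m)) (Suc z) B \<subseteq> I"
  using inside unfolding picture_cells_stack joint_def by simp_all

lemma relax_sound:
  assumes "\<And>i. i \<le> m \<Longrightarrow> slice_cells 1 (joint i) (Suc z) d \<subseteq> I"
    and "\<And>i. i \<le> m \<Longrightarrow> slice_cells 1 (Suc (joint i)) (Suc z) e \<subseteq> I"
  shows "picture_cells 1 (Suc z) (stack m (relax n d e (T, M, B))) \<subseteq> I"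
  unfolding relax.simps picture_cells_stack
proof (intro conjI allI impI)
  show "picture_cells 1 (Suc z) (butlast (spread n (T @ [e]))) \<subseteq> I"
    using block_cells(1) assms(2)[of 0] by (intro relax_top_sound) (simp_all add: joint_def)
next
  fix i assume "i < m"
  then show "picture_cells (Suc (length (butlast (spread n (T @ [e]))) +
      i * length (tl (butlast (spread n (d # M @ [e])))))) (Suc z)
      (tl (butlast (spread n (d # M @ [e])))) \<subseteq> I"
    using relax_middle_sound[OF joint_pos, of i z d M e] block_cells(2)
      assms(1)[of i] assms(2)[of "Suc i"]
    by (simp add: joint_def ac_simps)
next
  show "picture_cells (Suc (length (butlast (spread n (T @ [e]))) +
      m * length (tl (butlast (spread n (d # M @ [e])))))) (Suc z) (tl (spread n (d # B))) \<subseteq> I"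
    using relax_bottom_sound[OF joint_pos, of m z d B] block_cells(3) assms(1)[of m]
    by (simp add: joint_def)
qed

lemma common_foot_sound:
  assumes "i \<le> m"
  shows "slice_cells 1 (joint i) (Suc z) (common (foot T) (foot M)) \<subseteq> I"
proof (cases i)
  case 0
  then show ?thesis
    using picture_cells_foot[of 0 "Suc z" T I] block_cells(1) slice_cells_common(1)
    by (simp add: joint_def) blast
next
  case (Suc j)
  then show ?thesis
    using picture_cells_foot[of "joint j" "Suc z" M I] block_cells(2)[of j] assms slice_cells_common(2)
    by (simp add: joint_Suc) blast
qed

lemma common_head_sound:
  assumes "i \<le> m"
  shows "slice_cells 1 (Suc (joint i)) (Suc z) (common (head [] M) (head [] B)) \<subseteq> I"
proof (cases "i = m")
  case True
  then show ?thesis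
    using picture_cells_head[OF block_cells(3)] slice_cells_common(2) by blast
next
  case False
  then have "i < m" using assms by simp
  then show ?thesis
    using picture_cells_head[OF block_cells(2)] slice_cells_common(1) by blast
qed

lemma upward_sound:
  assumes "confirms (run_sweep n (Up e) (T, M, B)) (Up e)" and "i \<le> m"
  shows "slice_cells 1 (Suc (joint i)) (Suc z) e \<subseteq> I"
  using assms(2)
proof (induction i rule: inc_induct)
  case base
  have "picture_cells (Suc (joint m)) (Suc z) (tl (spread n (common (foot T) (foot M) # B))) \<subseteq> I"
    by (rule relax_bottom_sound[OF joint_pos common_foot_sound block_cells(3)]) simp
  then show ?case
    using slice_cells_contained picture_cells_head assms(1) by simp blast
next
  case (step i)
  have "picture_cells (Suc (joint i)) (Suc z)
      (tl (butlast (spread n (common (foot T) (foot M) # M @ [e])))) \<subseteq> I"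
    using step by (intro relax_middle_sound[OF joint_pos common_foot_sound block_cells(2)])
      (simp_all add: joint_Suc)
  then show ?case
    using slice_cells_contained picture_cells_head assms(1) by simp blast
qed

lemma downward_sound:
  assumes "confirms (run_sweep n (Down d) (T, M, B)) (Down d)" and "i \<le> m"
  shows "slice_cells 1 (joint i) (Suc z) d \<subseteq> I"
  using assms(2)
proof (induction i)
  case 0
  let ?T = "butlast (spread n (T @ [common (head [] M) (head [] B)]))"
  have "picture_cells 1 (Suc z) ?T \<subseteq> I"
    using common_head_sound[of 0] block_cells(1) by (intro relax_top_sound) (simp_all add: joint_def)
  then have "slice_cells 1 (joint 0) (Suc z) (foot ?T) \<subseteq> I"
    using picture_cells_foot[of 0 "Suc z" ?T I] by (simp add: joint_def)
  then show ?case using slice_cells_contained assms(1) by simp blast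
next
  case (Suc i)
  let ?M = "tl (butlast (spread n (d # M @ [common (head [] M) (head [] B)])))"
  have "picture_cells (Suc (joint i)) (Suc z) ?M \<subseteq> I"
    using Suc common_head_sound[of "Suc i"]
    by (intro relax_middle_sound[OF joint_pos _ block_cells(2)]) (simp_all add: joint_Suc)
  then have "slice_cells 1 (joint (Suc i)) (Suc z) (foot ?M) \<subseteq> I"
    using picture_cells_foot[of "joint i" "Suc z" ?M I] by (simp add: joint_Suc)
  then show ?case using slice_cells_contained assms(1) by simp blast
qed

lemma run_sweep_sound:
  assumes "confirms (run_sweep n w (T, M, B)) w"
  shows "picture_cells 1 (Suc z) (stack m (run_sweep n w (T, M, B))) \<subseteq> I"
proof (cases w)
  case (Up e)
  with assms show ?thesis using relax_sound common_foot_sound upward_sound by simp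
next
  case (Down d)
  with assms show ?thesis using relax_sound common_head_sound downward_sound by simp
qed

end

end

fun check_sweep :: "strip \<Rightarrow> sweep \<Rightarrow> strip option" where
  "check_sweep S w = (if confirms S w then Some S else None)"

fun sweeps :: "nat \<Rightarrow> sweep list \<Rightarrow> strip \<Rightarrow> strip option" where
  "sweeps n [] S = Some S"
| "sweeps n (w # ws) S = Option.bind (check_sweep (run_sweep n w S) w) (sweeps n ws)"

definition all_rows :: "nat \<Rightarrow> (row \<Rightarrow> bool) \<Rightarrow> picture \<Rightarrow> bool" where
  "all_rows a Q P \<longleftrightarrow> list_all (\<lambda>s. length s = a \<and> list_all Q s) P"

fun all_strip_rows :: "nat \<Rightarrow> (row \<Rightarrow> bool) \<Rightarrow> strip \<Rightarrow> bool" where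
  "all_strip_rows a Q (T, M, B) \<longleftrightarrow> all_rows a Q T \<and> all_rows a Q M \<and> all_rows a Q B"

definition full_from :: "nat \<Rightarrow> nat \<Rightarrow> row \<Rightarrow> bool" where
  "full_from k w r \<longleftrightarrow> length r = w \<and> list_all (\<lambda>q. q) (drop k r)"

definition fills :: "nat \<Rightarrow> nat \<Rightarrow> nat \<Rightarrow> nat \<Rightarrow> sweep list \<Rightarrow> strip \<Rightarrow> bool" where
  "fills n a w k ws S \<longleftrightarrow> fst S \<noteq> [] \<and>
     (case sweeps n ws S of None \<Rightarrow> False | Some S' \<Rightarrow> all_strip_rows a (full_from k w) S')"

lemma all_rows_stack: "all_strip_rows a Q S \<Longrightarrow> all_rows a Q (stack m S)"
  by (cases S) (auto simp: all_rows_def list_all_iff split: if_splits)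

lemma mem_row_cells_if_full:
  assumes "full_from k w r" and "z + k \<le> z'" and "z' < z + w"
  shows "(x, y, z') \<in> row_cells x y z r"
  using assms
proof (induction r arbitrary: z k w)
  case (Cons q r)
  show ?case
  proof (cases "z' = z")
    case True
    then have "k = 0" using Cons.prems(2) by simp
    then show ?thesis using True Cons.prems(1) by (simp add: full_from_def)
  next
    case False
    then show ?thesis
      using Cons.IH[of "k - 1" "w - 1" "Suc z"] Cons.prems by (cases k) (auto simp: full_from_def)
  qed
qed (simp add: full_from_def)

lemma mem_slice_cells_if_full:
  assumes "list_all (full_from k w) s"
    and "x \<le> x'" "x' < x + length s" and "z + k \<le> z'" "z' < z + w"
  shows "(x', y, z') \<in> slice_cells x y z s"
  using assms
proof (induction s arbitrary: x)
  case (Cons r s)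
  then show ?case by (cases "x' = x") (auto intro: mem_row_cells_if_full)
qed simp

lemma mem_picture_cells_if_full:
  assumes "all_rows a (full_from k w) P" and "x \<in> {1..a}"
    and "y \<le> y'" "y' < y + length P" and "z + k \<le> z'" "z' < z + w"
  shows "(x, y', z') \<in> picture_cells y z P"
  using assms
proof (induction P arbitrary: y)
  case (Cons s P)
  show ?case
  proof (cases "y' = y")
    case True
    have "(x, y', z') \<in> slice_cells 1 y' z s"
      by (rule mem_slice_cells_if_full) (use Cons.prems in \<open>auto simp: all_rows_def\<close>)
    then show ?thesis using True by simp
  next
    case False
    then show ?thesis using Cons by (auto simp: all_rows_def)
  qed
qed simp

fun height :: "nat \<Rightarrow> strip \<Rightarrow> nat" where
  "height m (T, M, B) = length T + m * length M + length B"

lemma length_stack: "length (stack m S) = height m S"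
  by (cases S) (simp add: length_concat sum_list_replicate)

lemma height_run_sweep: "height m (run_sweep n w S) = height m S"
  by (cases S; cases w) simp_all

lemma run_sweep_nonempty:
  assumes "fst S \<noteq> []"
  shows "fst (run_sweep n w S) \<noteq> []"
proof -
  have "length (fst (run_sweep n w S)) = length (fst S)" by (cases S; cases w) simp_all
  then show ?thesis using assms by (metis length_0_conv)
qed

context closed_grid_set
begin

lemma sweeps_sound:
  assumes "sweeps n ws S = Some S'" and "fst S \<noteq> []" and "picture_cells 1 (Suc z) (stack m S) \<subseteq> I"
  shows "picture_cells 1 (Suc z) (stack m S') \<subseteq> I \<and> height m S' = height m S"
  using assms
proof (induction ws arbitrary: S)
  case (Cons w ws)
  obtain T M B where S: "S = (T, M, B)" by (cases S)
  have confirms: "confirms (run_sweep n w S) w" and rest: "sweeps n ws (run_sweep n w S) = Some S'"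
    using Cons.prems(1) by (auto split: if_splits)
  have "picture_cells 1 (Suc z) (stack m (run_sweep n w S)) \<subseteq> I"
    using run_sweep_sound confirms Cons.prems(2,3) unfolding S by simp
  then show ?case
    using Cons.IH[OF rest run_sweep_nonempty[OF Cons.prems(2)]] by (simp add: height_run_sweep)
qed simp

lemma fills_sound:
  assumes "fills n a' w k ws S" and "picture_cells 1 (Suc z) (stack m S) \<subseteq> I"
    and "x \<in> {1..a'}" and "y \<in> {1..height m S}" and "z + k < z'" and "z' \<le> z + w"
  shows "(x, y, z') \<in> I"
proof -
  obtain S' where S': "sweeps n ws S = Some S'" "all_strip_rows a' (full_from k w) S'"
    using assms(1) unfolding fills_def by (auto split: option.splits)
  have "picture_cells 1 (Suc z) (stack m S') \<subseteq> I" and height: "height m S' = height m S"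
    using sweeps_sound[OF S'(1) _ assms(2)] assms(1) by (simp_all add: fills_def)
  moreover have "(x, y, z') \<in> picture_cells 1 (Suc z) (stack m S')"
    using all_rows_stack[OF S'(2)] assms(3-) height
    by (intro mem_picture_cells_if_full) (auto simp: length_stack)
  ultimately show ?thesis by blast
qed

end

definition seed_count :: "picture \<Rightarrow> nat" where
  "seed_count P = (\<Sum>s\<leftarrow>P. \<Sum>r\<leftarrow>s. count_list r True)"

lemma card_row_cells_le: "card (row_cells x y z r) \<le> count_list r True"
proof (induction r arbitrary: z)
  case (Cons q r)
  have "card (row_cells x y z (q # r)) \<le>
      card (if q then {(x, y, z)} else {}) + card (row_cells x y (Suc z) r)"
    unfolding row_cells.simps by (rule card_Un_le)
  also have "\<dots> \<le> count_list (q # r) True" using Cons[of "Suc z"] by simp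
  finally show ?case .
qed simp

lemma card_slice_cells_le: "card (slice_cells x y z s) \<le> (\<Sum>r\<leftarrow>s. count_list r True)"
proof (induction s arbitrary: x)
  case (Cons r s)
  have "card (slice_cells x y z (r # s)) \<le> card (row_cells x y z r) + card (slice_cells (Suc x) y z s)"
    by (simp add: card_Un_le)
  also have "\<dots> \<le> (\<Sum>r\<leftarrow>r # s. count_list r True)"
    using card_row_cells_le[of x y z r] Cons[of "Suc x"] by simp
  finally show ?case .
qed simp

lemma card_picture_cells_le: "card (picture_cells y z P) \<le> seed_count P"
proof (induction P arbitrary: y)
  case (Cons s P)
  have "card (picture_cells y z (s # P)) \<le> card (slice_cells 1 y z s) + card (picture_cells (Suc y) z P)"
    by (simp add: card_Un_le)
  also have "\<dots> \<le> seed_count (s # P)"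
    using card_slice_cells_le[of 1 y z s] Cons[of "Suc y"] by (simp add: seed_count_def)
  finally show ?case .
qed (simp add: seed_count_def)

section \<open>Patterns that repeat in two directions\<close>

definition segment :: "nat \<Rightarrow> nat \<Rightarrow> row \<Rightarrow> row" where
  "segment s w r = take w (drop s r)"

definition widen :: "nat \<Rightarrow> nat \<Rightarrow> nat \<Rightarrow> row \<Rightarrow> row" where
  "widen n l p r = take l r @ concat (replicate n (segment l p r)) @ drop (l + p) r"

fun map_rows :: "(row \<Rightarrow> row) \<Rightarrow> strip \<Rightarrow> strip" where
  "map_rows f (T, M, B) = (map (map f) T, map (map f) M, map (map f) B)"

lemma stack_map_rows: "stack m (map_rows f S) = map (map f) (stack m S)"
  by (cases S) (simp add: map_concat)

lemma height_map_rows [simp]: "height m (map_rows f S) = height m S"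
  by (cases S) simp

lemma row_cells_append: "row_cells x y z (r @ r') = row_cells x y z r \<union> row_cells x y (z + length r) r'"
  by (induction r arbitrary: z) auto

lemma row_cells_widen_suffix:
  assumes "l + p \<le> length r" and "j \<le> n"
  shows "row_cells x y (z + l + j * p) (concat (replicate (n - j) (segment l p r)) @ drop (l + p) r)
    \<subseteq> row_cells x y z (widen n l p r)"
proof -
  let ?C = "segment l p r"
  have "replicate n ?C = replicate j ?C @ replicate (n - j) ?C"
    using assms(2) by (simp flip: replicate_add)
  then have "widen n l p r = (take l r @ concat (replicate j ?C)) @
      concat (replicate (n - j) ?C) @ drop (l + p) r"
    by (simp add: widen_def)
  moreover have "length (take l r @ concat (replicate j ?C)) = l + j * p"
    using assms(1) by (simp add: segment_def length_concat sum_list_replicate)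
  ultimately show ?thesis by (simp only: row_cells_append) (simp add: add.assoc)
qed

lemma take_concat_replicate_append:
  assumes "k \<le> length C" and "take k C = take k R" and "k \<le> length R"
  shows "take k (concat (replicate i C) @ R) = take k R"
  using assms by (cases i) simp_all

lemma row_cells_take: "row_cells x y z (take k r) \<subseteq> row_cells x y z r"
  by (metis append_take_drop_id row_cells_append Un_upper1)

lemma segment_eq_take_suffix:
  assumes "length r = l + p + q" and "segment l k r = segment (l + p) k r" and "k \<le> p" and "k \<le> q"
    and "j < n"
  shows "segment l (p + k) r = take (p + k) (concat (replicate (n - j) (segment l p r)) @ drop (l + p) r)"
proof -
  obtain i where i: "n - j = Suc i" using assms(5) by (cases "n - j") auto
  have "take k (concat (replicate i (segment l p r)) @ drop (l + p) r) = segment (l + p) k r"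
    unfolding segment_def
    by (rule take_concat_replicate_append) (use assms in \<open>simp_all add: segment_def\<close>)
  moreover have "take (p + k) (concat (replicate (n - j) (segment l p r)) @ drop (l + p) r) =
      segment l p r @ take k (concat (replicate i (segment l p r)) @ drop (l + p) r)"
    using assms(1) by (simp add: i segment_def)
  moreover have "segment l (p + k) r = segment l p r @ segment (l + p) k r"
    by (simp add: segment_def take_add add.commute[of p l])
  ultimately show ?thesis by (simp only:)
qed

lemma segment_eq_take_widen:
  assumes "length r = l + p + q" and "segment l k r = segment (l + p) k r" and "k \<le> p" and "k \<le> q"
  shows "segment 0 (l + k) r = take (l + k) (widen n l p r)"
proof -
  have "take k (concat (replicate n (segment l p r)) @ drop (l + p) r) = segment (l + p) k r"
    unfolding segment_def
    by (rule take_concat_replicate_append) (use assms in \<open>simp_all add: segment_def\<close>)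
  then show ?thesis
    using assms(1,2) by (simp add: segment_def widen_def take_add)
qed

lemma row_cells_subset: "row_cells x y z r \<subseteq> {x} \<times> {y} \<times> {z..<z + length r}"
proof (induction r arbitrary: z)
  case (Cons q r)
  have "{x} \<times> {y} \<times> {Suc z..<Suc z + length r} \<subseteq> {x} \<times> {y} \<times> {z..<z + length (q # r)}"
    by auto
  with Cons[of "Suc z"] have "row_cells x y (Suc z) r \<subseteq> {x} \<times> {y} \<times> {z..<z + length (q # r)}"
    by (rule subset_trans)
  then show ?case by simp
qed simp

lemma slice_cells_subset:
  "list_all (\<lambda>r. length r = w) s \<Longrightarrow>
    slice_cells x y z s \<subseteq> {x..<x + length s} \<times> {y} \<times> {z..<z + w}"
proof (induction s arbitrary: x)
  case (Cons r s)
  let ?box = "{x..<x + length (r # s)} \<times> {y} \<times> {z..<z + w}"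
  have "slice_cells (Suc x) y z s \<subseteq> {Suc x..<Suc x + length s} \<times> {y} \<times> {z..<z + w}"
    using Cons.prems by (intro Cons.IH) simp
  also have "\<dots> \<subseteq> ?box" by auto
  finally have "slice_cells (Suc x) y z s \<subseteq> ?box" .
  moreover have "row_cells x y z r \<subseteq> ?box"
    using row_cells_subset[of x y z r] Cons.prems by auto
  ultimately show ?case by simp
qed simp

lemma picture_cells_subset:
  "all_rows a (\<lambda>r. length r = w) P \<Longrightarrow> picture_cells y z P \<subseteq> {1..a} \<times> {y..<y + length P} \<times> {z..<z + w}"
proof (induction P arbitrary: y)
  case (Cons s P)
  let ?box = "{1..a} \<times> {y..<y + length (s # P)} \<times> {z..<z + w}"
  have "picture_cells (Suc y) z P \<subseteq> {1..a} \<times> {Suc y..<Suc y + length P} \<times> {z..<z + w}"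
    using Cons.prems by (intro Cons.IH) (simp add: all_rows_def)
  also have "\<dots> \<subseteq> ?box" by auto
  finally have "picture_cells (Suc y) z P \<subseteq> ?box" .
  moreover have "slice_cells 1 y z s \<subseteq> ?box"
    using slice_cells_subset[of w s 1 y z] Cons.prems by (auto simp: all_rows_def)
  ultimately show ?case by simp
qed simp

lemma slice_cells_map:
  assumes "slice_cells x y z (map g s) \<subseteq> I"
    and "\<And>x' r. x \<le> x' \<Longrightarrow> x' < x + length s \<Longrightarrow> r \<in> set s \<Longrightarrow>
      row_cells x' y z (g r) \<subseteq> I \<Longrightarrow> row_cells x' y z' (f r) \<subseteq> I"
  shows "slice_cells x y z' (map f s) \<subseteq> I"
  using assms
proof (induction s arbitrary: x)
  case (Cons r s)
  have "row_cells x y z' (f r) \<subseteq> I" using Cons.prems(1) by (intro Cons.prems(2)) auto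
  moreover have "slice_cells (Suc x) y z' (map f s) \<subseteq> I"
    using Cons.prems(1) by (intro Cons.IH Cons.prems(2)) auto
  ultimately show ?case by simp
qed simp

lemma picture_cells_map:
  assumes "all_rows a Q P" and "picture_cells y z (map (map g) P) \<subseteq> I"
    and "\<And>x y' r. x \<in> {1..a} \<Longrightarrow> y \<le> y' \<Longrightarrow> y' < y + length P \<Longrightarrow> Q r \<Longrightarrow>
      row_cells x y' z (g r) \<subseteq> I \<Longrightarrow> row_cells x y' z' (f r) \<subseteq> I"
  shows "picture_cells y z' (map (map f) P) \<subseteq> I"
  using assms
proof (induction P arbitrary: y)
  case (Cons s P)
  have "slice_cells 1 y z' (map f s) \<subseteq> I"
  proof (rule slice_cells_map)
    show "slice_cells 1 y z (map g s) \<subseteq> I" using Cons.prems(2) by simp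
    fix x r assume "1 \<le> x" "x < 1 + length s" "r \<in> set s" "row_cells x y z (g r) \<subseteq> I"
    then show "row_cells x y z' (f r) \<subseteq> I"
      using Cons.prems(1) by (intro Cons.prems(3)) (auto simp: all_rows_def list_all_iff)
  qed
  moreover have "picture_cells (Suc y) z' (map (map f) P) \<subseteq> I"
    using Cons.prems(1,2) by (intro Cons.IH Cons.prems(3)) (auto simp: all_rows_def)
  ultimately show ?case by simp
qed simp

lemma seed_count_append: "seed_count (P @ Q) = seed_count P + seed_count Q"
  by (simp add: seed_count_def)

lemma seed_count_stack:
  "seed_count (stack m (T, M, B)) = seed_count T + m * seed_count M + seed_count B"
  by (induction m) (simp_all add: seed_count_def)

definition margins :: "nat \<Rightarrow> nat \<Rightarrow> row \<Rightarrow> row" where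
  "margins l p r = take l r @ drop (l + p) r"

lemma count_list_concat_replicate: "count_list (concat (replicate n r)) q = n * count_list r q"
  by (induction n) simp_all

lemma seed_count_widen:
  "seed_count (map (map (widen n l p)) P) =
    seed_count (map (map (margins l p)) P) + n * seed_count (map (map (segment l p)) P)"
proof -
  have "count_list (widen n l p r) True =
      count_list (margins l p r) True + n * count_list (segment l p r) True" for r
    by (simp add: widen_def margins_def segment_def count_list_concat_replicate)
  then show ?thesis
    by (simp add: seed_count_def comp_def sum_list_addf sum_list_const_mult)
qed

fun balanced :: "nat \<Rightarrow> nat \<Rightarrow> nat \<Rightarrow> nat \<Rightarrow> strip \<Rightarrow> bool" where
  "balanced a l p q (T, M, B) \<longleftrightarrow>
     (let ends = \<lambda>f. seed_count (map (map f) (T @ B)); mid = \<lambda>f. seed_count (map (map f) M);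
        b = length T + length B; c = l + q in
      3 * ends (margins l p) = a * b + a * c + b * c \<and>
      3 * mid (margins l p) = length M * (a + c) \<and>
      3 * ends (segment l p) = p * (a + b) \<and>
      3 * mid (segment l p) = length M * p)"

lemma seed_count_if_balanced:
  assumes "balanced a l p q S"
  shows "3 * seed_count (map (map (widen n l p)) (stack m S)) =
    a * height m S + a * (l + n * p + q) + height m S * (l + n * p + q)"
proof -
  obtain T M B where S: "S = (T, M, B)" by (cases S)
  have stack: "map (map f) (stack m S) = stack m (map (map f) T, map (map f) M, map (map f) B)" for f
    by (simp add: S map_concat)
  have "3 * seed_count (map (map (widen n l p)) (stack m S)) =
      3 * seed_count (map (map (margins l p)) (T @ B)) +
      m * (3 * seed_count (map (map (margins l p)) M)) +
      n * (3 * seed_count (map (map (segment l p)) (T @ B)) +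
        m * (3 * seed_count (map (map (segment l p)) M)))"
    unfolding seed_count_widen unfolding stack unfolding seed_count_stack
    by (simp only: map_append seed_count_append) (simp add: algebra_simps)
  also have "\<dots> = a * height m S + a * (l + n * p + q) + height m S * (l + n * p + q)"
    using assms unfolding S balanced.simps Let_def height.simps
    by (simp only:) (simp add: algebra_simps)
  finally show ?thesis .
qed

text \<open>
  The columns of \<open>S\<close> form three groups of widths \<open>l\<close>, \<open>p\<close>, \<open>q\<close>, the second of which may be repeated. The
  first \<open>k\<close> columns of the second and third group agree. Each group is swept together with the first
  \<open>k\<close> columns of the group to its right, and the next column is already infected; the first \<open>k\<close>
  columns of the group itself may remain uninfected until the group to its left is swept. With
  \<open>l = p = k = 0\<close> nothing is repeated on the \<open>z\<close>-axis. \<open>N\<close> is the number of passes of \<^const>\<open>spread\<close>.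
\<close>

definition valid_pattern ::
  "nat \<Rightarrow> nat \<Rightarrow> nat \<Rightarrow> nat \<Rightarrow> nat \<Rightarrow> nat \<Rightarrow> sweep list \<Rightarrow> sweep list \<Rightarrow> sweep list \<Rightarrow> strip \<Rightarrow> bool" where
  "valid_pattern N a l p q k ls ms rs S \<longleftrightarrow>
     0 < a \<and> k \<le> p \<and> k < q \<and>
     all_strip_rows a (\<lambda>r. length r = l + p + q \<and> segment l k r = segment (l + p) k r) S \<and>
     balanced a l p q S \<and>
     fills N a (l + k + 1) 0 ls (map_rows (\<lambda>r. segment 0 (l + k) r @ [True]) S) \<and>
     fills N a (p + k + 1) k ms (map_rows (\<lambda>r. segment l (p + k) r @ [True]) S) \<and>
     fills N a q k rs (map_rows (segment (l + p) q) S)"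

locale pattern =
  fixes N a l p q k :: nat and ls ms rs :: "sweep list" and S :: strip and m n :: nat
  assumes valid: "valid_pattern N a l p q k ls ms rs S"
begin

definition width :: nat where
  "width = l + n * p + q"

definition seeds :: "vertex3 set" where
  "seeds = picture_cells 1 1 (map (map (widen n l p)) (stack m S))"

lemma sizes: "0 < a" "k \<le> p" "k < q"
  using valid by (simp_all add: valid_pattern_def)

lemma rows: "all_rows a (\<lambda>r. length r = l + p + q \<and> segment l k r = segment (l + p) k r) (stack m S)"
  using valid by (simp add: valid_pattern_def all_rows_stack)

lemma seeds_subset: "seeds \<subseteq> grid_verts a (height m S) width"
proof -
  have "all_rows a (\<lambda>r. length r = width) (map (map (widen n l p)) (stack m S))"
    using rows
    by (auto simp: all_rows_def list_all_iff width_def widen_def segment_def length_concat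
      sum_list_replicate)
  from picture_cells_subset[OF this, of 1 1] show ?thesis
    unfolding seeds_def grid_verts_def by (auto simp: length_stack atLeastLessThanSuc_atLeastAtMost)
qed

lemma card_seeds:
  "3 * card seeds \<le> a * height m S + a * width + height m S * width"
  "3 dvd a * height m S + a * width + height m S * width"
proof -
  have total: "3 * seed_count (map (map (widen n l p)) (stack m S)) =
      a * height m S + a * width + height m S * width"
    using valid by (simp add: width_def valid_pattern_def seed_count_if_balanced)
  show "3 * card seeds \<le> a * height m S + a * width + height m S * width"
    unfolding total[symmetric] seeds_def using card_picture_cells_le by simp
  show "3 dvd a * height m S + a * width + height m S * width"
    unfolding total[symmetric] by simp
qed

context
  fixes I :: "vertex3 set"
  assumes closed: "closed_grid_set a (height m S) width I" and seeds: "seeds \<subseteq> I"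
begin

interpretation closed_grid_set a "height m S" width I
  by (rule closed)

lemma window_filled:
  assumes "fills N a w k' ws (map_rows f S)"
    and row: "\<And>x y r. x \<in> {1..a} \<Longrightarrow> y \<in> {1..height m S} \<Longrightarrow> length r = l + p + q \<Longrightarrow>
      segment l k r = segment (l + p) k r \<Longrightarrow> row_cells x y 1 (widen n l p r) \<subseteq> I \<Longrightarrow>
      row_cells x y (Suc z) (f r) \<subseteq> I"
  shows "{1..a} \<times> {1..height m S} \<times> {z + k'<..z + w} \<subseteq> I"
proof -
  have "picture_cells 1 (Suc z) (stack m (map_rows f S)) \<subseteq> I"
    unfolding stack_map_rows
    by (rule picture_cells_map[OF rows seeds[unfolded seeds_def]]) (rule row, auto simp: length_stack)
  then have "(x, y, z') \<in> I"
    if "x \<in> {1..a}" "y \<in> {1..height m S}" "z + k' < z'" "z' \<le> z + w" for x y z'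
    using fills_sound[OF assms(1)] that by simp
  then show ?thesis by auto
qed

lemma right_columns_subset: "{1..a} \<times> {1..height m S} \<times> {l + n * p + k<..width} \<subseteq> I"
proof -
  have "fills N a q k rs (map_rows (segment (l + p) q) S)"
    using valid by (simp add: valid_pattern_def)
  then show ?thesis unfolding width_def
  proof (rule window_filled)
    fix x y r assume "length r = l + p + q" "row_cells x y 1 (widen n l p r) \<subseteq> I"
    then show "row_cells x y (Suc (l + n * p)) (segment (l + p) q r) \<subseteq> I"
      using row_cells_widen_suffix[of l p r n n x y 1] by (simp add: segment_def)
  qed
qed

lemma middle_columns_subset:
  assumes "j < n" and infected: "{1..a} \<times> {1..height m S} \<times> {l + Suc j * p + k<..width} \<subseteq> I"
  shows "{1..a} \<times> {1..height m S} \<times> {(l + j * p) + k<..(l + j * p) + (p + k + 1)} \<subseteq> I"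
proof -
  have "Suc j * p \<le> n * p" using assms(1) by (intro mult_le_mono1) simp
  then have width: "l + Suc j * p + k < width" using sizes unfolding width_def by linarith
  have "fills N a (p + k + 1) k ms (map_rows (\<lambda>r. segment l (p + k) r @ [True]) S)"
    using valid by (simp add: valid_pattern_def)
  then show ?thesis
  proof (rule window_filled)
    fix x y r
    assume xy: "x \<in> {1..a}" "y \<in> {1..height m S}"
      and r: "length r = l + p + q" "segment l k r = segment (l + p) k r"
      and row: "row_cells x y 1 (widen n l p r) \<subseteq> I"
    have "row_cells x y (Suc (l + j * p))
        (concat (replicate (n - j) (segment l p r)) @ drop (l + p) r) \<subseteq> I"
      using row_cells_widen_suffix[of l p r j n x y 1] r(1) row assms(1) by simp
    then have "row_cells x y (Suc (l + j * p)) (segment l (p + k) r) \<subseteq> I"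
      using segment_eq_take_suffix[OF r, of j n] sizes assms(1) row_cells_take
      by (metis less_imp_le subset_trans)
    moreover have "(x, y, Suc (l + Suc j * p + k)) \<in> I"
      using infected xy width by auto
    ultimately show "row_cells x y (Suc (l + j * p)) (segment l (p + k) r @ [True]) \<subseteq> I"
      using r(1) sizes by (simp add: row_cells_append segment_def ac_simps)
  qed
qed

lemma columns_from_subset:
  assumes "j \<le> n"
  shows "{1..a} \<times> {1..height m S} \<times> {l + j * p + k<..width} \<subseteq> I"
  using assms
proof (induction j rule: inc_induct)
  case base
  show ?case by (rule right_columns_subset)
next
  case (step j)
  have "{l + j * p + k<..width} \<subseteq>
      {(l + j * p) + k<..(l + j * p) + (p + k + 1)} \<union> {l + Suc j * p + k<..width}"
    by auto
  then show ?case using middle_columns_subset[OF step(2) step.IH] step.IH by blast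
qed

lemma grid_subset: "grid_verts a (height m S) width \<subseteq> I"
proof -
  have width: "l + k < width" using sizes by (simp add: width_def)
  have "fills N a (l + k + 1) 0 ls (map_rows (\<lambda>r. segment 0 (l + k) r @ [True]) S)"
    using valid by (simp add: valid_pattern_def)
  then have "{1..a} \<times> {1..height m S} \<times> {0 + 0<..0 + (l + k + 1)} \<subseteq> I"
  proof (rule window_filled)
    fix x y r
    assume xy: "x \<in> {1..a}" "y \<in> {1..height m S}"
      and r: "length r = l + p + q" "segment l k r = segment (l + p) k r"
      and row: "row_cells x y 1 (widen n l p r) \<subseteq> I"
    have "row_cells x y 1 (segment 0 (l + k) r) \<subseteq> I"
      using segment_eq_take_widen[OF r, of n] sizes row row_cells_take
      by (metis less_imp_le subset_trans)
    moreover have "(x, y, Suc (l + k)) \<in> I"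
      using columns_from_subset[of 0] xy width by auto
    ultimately show "row_cells x y (Suc 0) (segment 0 (l + k) r @ [True]) \<subseteq> I"
      using r(1) sizes by (simp add: row_cells_append segment_def)
  qed
  moreover have "grid_verts a (height m S) width \<subseteq>
      {1..a} \<times> {1..height m S} \<times> ({0 + 0<..0 + (l + k + 1)} \<union> {l + 0 * p + k<..width})"
    by (auto simp: grid_verts_def)
  ultimately show ?thesis using columns_from_subset[of 0] by blast
qed

end

lemma height_pos: "0 < height m S"
proof -
  have "fst (map_rows (segment (l + p) q) S) \<noteq> []"
    using valid by (simp add: valid_pattern_def fills_def)
  then show ?thesis by (cases S) simp
qed

lemma perfect: "perfect_grid a (height m S) width"
proof (rule perfect_grid_if_card_le)
  show "percolates 3 (grid_verts a (height m S) width) grid_adj seeds"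
  proof (rule percolatesI[OF finite_grid_verts seeds_subset])
    fix I assume I: "infection_closed 3 (grid_verts a (height m S) width) grid_adj I"
      "I \<subseteq> grid_verts a (height m S) width" "seeds \<subseteq> I"
    then have "closed_grid_set a (height m S) width I" by unfold_locales
    then show "grid_verts a (height m S) width \<subseteq> I" using I(3) by (rule grid_subset)
  qed
qed (use sizes height_pos card_seeds in \<open>simp_all add: width_def\<close>)

end

lemma perfect_grid_if_valid_pattern:
  assumes "valid_pattern N a l p q k ls ms rs S" and "height m S = b" and "l + n * p + q = c"
  shows "perfect_grid a b c"
  using pattern.perfect[OF pattern.intro[OF assms(1)], of m n] assms(2,3)
  by (simp add: pattern.width_def[OF pattern.intro[OF assms(1)]])

abbreviation valid_strip :: "nat \<Rightarrow> nat \<Rightarrow> nat \<Rightarrow> sweep list \<Rightarrow> strip \<Rightarrow> bool" where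
  "valid_strip N a w ws S \<equiv> valid_pattern N a 0 0 w 0 [] [] ws S"

lemma perfect_grid_if_valid_strip:
  assumes "valid_strip N a c ws S" and "height m S = b"
  shows "perfect_grid a b c"
  using perfect_grid_if_valid_pattern[OF assms, of 0] by simp

section \<open>The patterns\<close>

definition bits :: "string list \<Rightarrow> slice" where
  "bits = map (map (\<lambda>c. c = CHR ''#''))"

fun drawn :: "string list list \<times> string list list \<times> string list list \<Rightarrow> strip" where
  "drawn (T, M, B) = (map bits T, map bits M, map bits B)"

definition pattern_2_8_8 :: strip where
  "pattern_2_8_8 = drawn
    ([[''...#...#..#'', ''#.#..#...#.''],
      [''#.....#..#.'', ''....#......''],
      [''.#......#.#'', ''...#..#....''],
      [''#..........'', ''..#..#.#.#.''],
      [''......#.#.#'', ''...#.......''],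
      [''.#.....#.#.'', ''#...#.....#'']],
     [[''......#....'', ''.#.#.....#.''],
      [''........#.#'', ''#...#......''],
      [''......#..#.'', ''.#.#...#...''],
      [''........#.#'', ''#...#......''],
      [''...........'', ''.#.#..#..#.''],
      [''........#..'', ''#...#..#..#'']],
     [[''......#....'', ''.#.#.....#.''],
      [''....#..#..#'', ''#.#..#..#..'']])"

lemma valid_pattern_2_8_8:
  "valid_pattern 2 2 2 3 6 1
    [Up (bits [''...#'', ''####'']),
      Down (bits [''####'', ''####''])]
    [Down (bits [''....#'', ''.####'']),
      Up (bits [''..###'', ''.####'']),
      Down (bits [''.####'', ''.####''])]
    [Up (bits [''.#....'', ''....#.'']),
      Down (bits [''.#####'', ''.#####''])]
    pattern_2_8_8"
  unfolding pattern_2_8_8_def by code_simp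

lemma perfect_grid_2_8_8: "perfect_grid 2 (8 + 6 * m) (8 + 3 * n)"
  by (rule perfect_grid_if_valid_pattern[OF valid_pattern_2_8_8, where m = m and n = n])
    (simp_all add: pattern_2_8_8_def)

definition pattern_2_6_6 :: strip where
  "pattern_2_6_6 = drawn
    ([[''..#..#...'', ''#...#.#.#'']],
     [[''........#'', ''.#.#...#.''],
      [''.........'', ''#...#.#..''],
      [''......#..'', ''.#.#....#''],
      [''.......#.'', ''#...#.#..''],
      [''........#'', ''.#.#.....''],
      [''.........'', ''#...#.#.#'']],
     [[''......#.#'', ''.#.#...#.''],
      [''.........'', ''#.#..#...''],
      [''...#...#.'', ''......#.#''],
      [''..#..#...'', ''#........''],
      [''#..#..#.#'', ''.#..#..#.'']])"

lemma valid_pattern_2_6_6: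
  "valid_pattern 1 2 2 3 4 1
    [Up (bits [''...#'', ''####'']),
      Down (bits [''..##'', ''####'']),
      Up (bits [''####'', ''####''])]
    [Down (bits [''...##'', ''..###'']),
      Up (bits [''.####'', ''.####''])]
    [Up (bits [''.###'', ''.###'']),
      Down (bits [''.###'', ''.###''])]
    pattern_2_6_6"
  unfolding pattern_2_6_6_def by code_simp

lemma perfect_grid_2_6_6: "perfect_grid 2 (6 + 6 * m) (6 + 3 * n)"
  by (rule perfect_grid_if_valid_pattern[OF valid_pattern_2_6_6, where m = m and n = n])
    (simp_all add: pattern_2_6_6_def)

definition pattern_2_8_5 :: strip where
  "pattern_2_8_5 = drawn
    ([[''.#...'', ''#.#.#''],
      [''.....'', ''...#.''],
      [''#.#..'', ''....#'']],
     [[''.#.#.'', ''#....''],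
      [''....#'', ''.....''],
      [''#.#..'', ''....#'']],
     [[''.#.#.'', ''#....''],
      [''....#'', ''.....''],
      [''#.#..'', ''.#.#.''],
      [''.....'', ''#...#''],
      [''#...#'', ''.#.#.'']])"

lemma valid_strip_2_8_5:
  "valid_strip 1 2 5
    [Up (bits [''#####'', ''#####''])]
    pattern_2_8_5"
  unfolding pattern_2_8_5_def by code_simp

lemma perfect_grid_2_8_5: "perfect_grid 2 (8 + 3 * m) 5"
  by (rule perfect_grid_if_valid_strip[OF valid_strip_2_8_5, where m = m])
    (simp_all add: pattern_2_8_5_def)

definition pattern_2_5_5 :: strip where
  "pattern_2_5_5 = drawn
    ([[''.#..#'', ''#.#..''],
      [''#..#.'', ''.....''],
      [''.....'', ''#.#.#''],
      [''....#'', ''.#...''],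
      [''...#.'', ''#.#.#'']],
     [],
     [])"

lemma valid_strip_2_5_5:
  "valid_strip 2 2 5
    [Up []]
    pattern_2_5_5"
  unfolding pattern_2_5_5_def by code_simp

lemma perfect_grid_2_5_5: "perfect_grid 2 5 5"
  by (rule perfect_grid_if_valid_strip[OF valid_strip_2_5_5, where m = 0])
    (simp_all add: pattern_2_5_5_def)

definition pattern_2_6_3 :: strip where
  "pattern_2_6_3 = drawn
    ([[''#.#'', ''.#.''],
      [''...'', ''..#''],
      [''.#.'', ''#..'']],
     [[''..#'', ''.#.''],
      [''...'', ''#..''],
      [''.#.'', ''..#''],
      [''#..'', ''.#.''],
      [''..#'', ''...''],
      [''.#.'', ''#..'']],
     [[''#.#'', ''...''],
      [''...'', ''#..''],
      [''#.#'', ''.#.'']])"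

lemma valid_strip_2_6_3:
  "valid_strip 1 2 3
    [Up (bits [''###'', ''##.'']),
      Down (bits [''###'', ''###''])]
    pattern_2_6_3"
  unfolding pattern_2_6_3_def by code_simp

lemma perfect_grid_2_6_3: "perfect_grid 2 (6 + 6 * m) 3"
  by (rule perfect_grid_if_valid_strip[OF valid_strip_2_6_3, where m = m])
    (simp_all add: pattern_2_6_3_def)

definition pattern_2_9_3 :: strip where
  "pattern_2_9_3 = drawn
    ([[''.#.'', ''#.#''],
      [''..#'', ''...''],
      [''...'', ''#.#'']],
     [[''#..'', ''.#.''],
      [''...'', ''..#''],
      [''.#.'', ''#..''],
      [''#.#'', ''...''],
      [''...'', ''.#.''],
      [''..#'', ''#..'']],
     [[''#..'', ''.#.''],
      [''...'', ''..#''],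
      [''#..'', ''.#.''],
      [''...'', ''#.#''],
      [''#..'', ''...''],
      [''.#.'', ''#.#'']])"

lemma valid_strip_2_9_3:
  "valid_strip 1 2 3
    [Up (bits [''##.'', ''##.'']),
      Down (bits [''###'', ''###''])]
    pattern_2_9_3"
  unfolding pattern_2_9_3_def by code_simp

lemma perfect_grid_2_9_3: "perfect_grid 2 (9 + 6 * m) 3"
  by (rule perfect_grid_if_valid_strip[OF valid_strip_2_9_3, where m = m])
    (simp_all add: pattern_2_9_3_def)

definition pattern_4_4_4 :: strip where
  "pattern_4_4_4 = drawn
    ([[''#.#.'', ''...#'', ''.#..'', ''#...''],
      [''.#.#'', ''#...'', ''....'', ''.#.#'']],
     [[''....'', ''....'', ''.#..'', ''..#.''],
      [''#..#'', ''.#..'', ''....'', ''....''],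
      [''.#..'', ''....'', ''#...'', ''...#'']],
     [[''....'', ''....'', ''.#..'', ''..#.''],
      [''#..#'', ''.#..'', ''....'', ''...#'']])"

lemma valid_strip_4_4_4:
  "valid_strip 2 4 4
    [Down (bits [''####'', ''####'', ''####'', ''####''])]
    pattern_4_4_4"
  unfolding pattern_4_4_4_def by code_simp

lemma perfect_grid_4_4_4: "perfect_grid 4 (4 + 3 * m) 4"
  by (rule perfect_grid_if_valid_strip[OF valid_strip_4_4_4, where m = m])
    (simp_all add: pattern_4_4_4_def)

definition pattern_4_7_7 :: strip where
  "pattern_4_7_7 = drawn
    ([[''#....#.'', ''.#.#..#'', ''.......'', ''.#.....''],
      [''....#..'', ''.......'', ''..#....'', ''#......''],
      [''...#...'', ''......#'', ''...#...'', ''.#.....'']],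
     [[''.....#.'', ''.#.....'', ''#......'', ''..#....''],
      [''.......'', ''#......'', ''....#..'', ''......#''],
      [''...#...'', ''......#'', ''...#...'', ''.#.....'']],
     [[''..#...#'', ''.#.....'', ''....#.#'', ''#......''],
      [''....#..'', ''#.#..#.'', ''...#...'', ''.......''],
      [''.......'', ''....#..'', ''.......'', ''#..#..#''],
      [''...#...'', ''#.#..#.'', ''.#....#'', ''.....#.'']])"

lemma valid_strip_4_7_7:
  "valid_strip 5 4 7
    [Up (bits [''..#####'', ''#######'', ''#######'', ''#######'']),
      Down (bits [''#######'', ''#######'', ''#######'', ''#######''])]
    pattern_4_7_7"
  unfolding pattern_4_7_7_def by code_simp

lemma perfect_grid_4_7_7: "perfect_grid 4 (7 + 3 * m) 7"
  by (rule perfect_grid_if_valid_strip[OF valid_strip_4_7_7, where m = m])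
    (simp_all add: pattern_4_7_7_def)

definition pattern_4_6_6 :: strip where
  "pattern_4_6_6 = drawn
    ([[''....#.'', ''..#..#'', ''#.....'', ''.....#''],
      [''.....#'', ''......'', ''...#..'', ''.#....'']],
     [[''#.....'', ''.....#'', ''..#.#.'', ''......''],
      [''......'', ''#.....'', ''.....#'', ''..#...''],
      [''.....#'', ''......'', ''...#..'', ''.#....'']],
     [[''#.#.#.'', ''......'', ''....#.'', ''..#...''],
      [''.#.#.#'', ''......'', ''.....#'', ''....#.''],
      [''#.....'', ''..#..#'', ''#.....'', ''...#..''],
      [''.#.#.#'', ''#.....'', ''......'', ''#.....'']])"

lemma valid_strip_4_6_6:
  "valid_strip 3 4 6
    [Up (bits [''######'', ''######'', ''######'', ''#####.'']),
      Down (bits [''######'', ''######'', ''######'', ''######''])]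
    pattern_4_6_6"
  unfolding pattern_4_6_6_def by code_simp

lemma perfect_grid_4_6_6: "perfect_grid 4 (6 + 3 * m) 6"
  by (rule perfect_grid_if_valid_strip[OF valid_strip_4_6_6, where m = m])
    (simp_all add: pattern_4_6_6_def)

definition pattern_4_9_9 :: strip where
  "pattern_4_9_9 = drawn
    ([[''#........'', ''...#.....'', ''.#...#.#.'', ''...#....#''],
      [''........#'', ''..#......'', ''......#..'', ''..#.#....''],
      [''...#.....'', ''.........'', ''..#....#.'', ''#....#...''],
      [''..#..#.#.'', ''.#.#....#'', ''#........'', ''...#..#..''],
      [''......#..'', ''.......#.'', ''....#....'', ''#........''],
      [''.....#...'', ''........#'', ''.#.#.....'', ''....#....''],
      [''#.......#'', ''.....#...'', ''#.#......'', ''......#..''],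
      [''.........'', ''.#.......'', ''...#....#'', ''.........''],
      [''#.......#'', ''..#..#...'', ''....#..#.'', ''......#..'']],
     [],
     [])"

lemma valid_strip_4_9_9:
  "valid_strip 6 4 9
    [Up []]
    pattern_4_9_9"
  unfolding pattern_4_9_9_def by code_simp

lemma perfect_grid_4_9_9: "perfect_grid 4 9 9"
  by (rule perfect_grid_if_valid_strip[OF valid_strip_4_9_9, where m = 0])
    (simp_all add: pattern_4_9_9_def)

section \<open>Grids of thickness 2 and 4\<close>

lemma perfect_grid_2_mod_3_eq_2:
  assumes b: "b = 5 \<or> (\<exists>m. b = 8 + 6 * m)" and c: "5 \<le> c" "c mod 3 = 2"
  shows "perfect_grid 2 b c"
proof -
  have five: "perfect_grid 2 5 d" if "5 \<le> d" "d mod 3 = 2" for d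
  proof -
    have "d = 5 \<or> (\<exists>m. d = 8 + 3 * m)" using that by presburger
    then show ?thesis using perfect_grid_2_5_5 perfect_grid_swap[OF perfect_grid_2_8_5] by blast
  qed
  from b show ?thesis
  proof
    assume large: "\<exists>m. b = 8 + 6 * m"
    then have "5 \<le> b" "b mod 3 = 2" by presburger+
    then have "perfect_grid 2 b 5" by (intro perfect_grid_swap[OF five])
    moreover have "c = 5 \<or> (\<exists>n. c = 8 + 3 * n)" using c by presburger
    ultimately show ?thesis using perfect_grid_2_8_8 large by auto
  qed (use five c in simp)
qed

lemma perfect_grid_2_mod_3_eq_0:
  assumes b: "b = 3 \<or> (\<exists>m. b = 6 + 6 * m)" and c: "6 \<le> c" "c mod 3 = 0"
  shows "perfect_grid 2 b c"
  using b
proof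
  assume "b = 3"
  have "(\<exists>m. c = 6 + 6 * m) \<or> (\<exists>m. c = 9 + 6 * m)" using c by presburger
  then show ?thesis
    using \<open>b = 3\<close> perfect_grid_swap[OF perfect_grid_2_6_3] perfect_grid_swap[OF perfect_grid_2_9_3]
    by blast
next
  assume "\<exists>m. b = 6 + 6 * m"
  moreover have "\<exists>n. c = 6 + 3 * n" using c by presburger
  ultimately show ?thesis using perfect_grid_2_6_6 by blast
qed

lemma perfect_grid_4_add_mod_3_eq_1:
  assumes "d = 5 \<or> (\<exists>m. d = 8 + 6 * m)" and "e = 5 \<or> (\<exists>m. e = 8 + 6 * m)"
    and c: "10 \<le> c" "c mod 3 = 1"
  shows "perfect_grid 4 (d + e) c"
proof -
  have "\<exists>n. c = 5 + (5 + 3 * n)" using c by presburger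
  then obtain n where n: "c = 5 + (5 + 3 * n)" ..
  have "(5 + 3 * n) mod 3 = 2" by presburger
  then have "perfect_grid (2 + 2) (d + e) (5 + (5 + 3 * n))"
    using assms(1,2) by (intro perfect_grid_octants perfect_grid_2_mod_3_eq_2) auto
  then show ?thesis by (simp add: n)
qed

lemma perfect_grid_4_mod_3_eq_1:
  assumes "b mod 3 = 1" and "c mod 3 = 1" and "4 \<le> b" and "b \<le> c"
  shows "perfect_grid 4 b c"
proof -
  have "b = 4 \<or> b = 7 \<or> 10 \<le> b" using assms by presburger
  then consider (four) "b = 4" | (seven) "b = 7" | (large) "10 \<le> b" by blast
  then show ?thesis
  proof cases
    case four
    have "\<exists>m. c = 4 + 3 * m" using assms four by presburger
    then show ?thesis using four perfect_grid_swap[OF perfect_grid_4_4_4] by auto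
  next
    case seven
    have "\<exists>m. c = 7 + 3 * m" using assms seven by presburger
    then show ?thesis using seven perfect_grid_swap[OF perfect_grid_4_7_7] by auto
  next
    case large
    have "\<exists>i. b = 5 + 5 \<or> b = 8 + (8 + 6 * i) \<or> b = 5 + (8 + 6 * i)"
      using assms(1) large by presburger
    moreover have "10 \<le> c" using large assms(4) by simp
    ultimately show ?thesis
      using perfect_grid_4_add_mod_3_eq_1[of 5 5 c] perfect_grid_4_add_mod_3_eq_1[of 8 "8 + 6 * _" c]
        perfect_grid_4_add_mod_3_eq_1[of 5 "8 + 6 * _" c] assms(2) by auto
  qed
qed

lemma perfect_grid_4_add_mod_3_eq_0:
  assumes "d = 3 \<or> d = 6" and c: "12 \<le> c" "c mod 3 = 0"
  shows "perfect_grid 4 (d + (6 + 6 * i)) c"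
proof -
  have "\<exists>n. c = 6 + (6 + 3 * n)" using c by presburger
  then obtain n where n: "c = 6 + (6 + 3 * n)" ..
  have "perfect_grid (2 + 2) (d + (6 + 6 * i)) (6 + (6 + 3 * n))"
    using assms(1) by (intro perfect_grid_octants perfect_grid_2_mod_3_eq_0) auto
  then show ?thesis by (simp add: n)
qed

lemma perfect_grid_4_mod_3_eq_0:
  assumes "b mod 3 = 0" and "c mod 3 = 0" and "4 \<le> b" and "b \<le> c"
  shows "perfect_grid 4 b c"
proof -
  have "b = 6 \<or> b = 9 \<and> c = 9 \<or> 9 \<le> b \<and> 12 \<le> c" using assms by presburger
  then consider (six) "b = 6" | (nine) "b = 9" "c = 9" | (large) "9 \<le> b" "12 \<le> c" by blast
  then show ?thesis
  proof cases
    case six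
    have "\<exists>m. c = 6 + 3 * m" using assms six by presburger
    then show ?thesis using six perfect_grid_swap[OF perfect_grid_4_6_6] by auto
  next
    case nine
    then show ?thesis using perfect_grid_4_9_9 by simp
  next
    case large
    have "\<exists>i. b = 3 + (6 + 6 * i) \<or> b = 6 + (6 + 6 * i)"
      using assms(1) large(1) by presburger
    then obtain i where "b = 3 + (6 + 6 * i) \<or> b = 6 + (6 + 6 * i)" ..
    then show ?thesis
      using perfect_grid_4_add_mod_3_eq_0[of 3 c i] perfect_grid_4_add_mod_3_eq_0[of 6 c i]
        large(2) assms(2) by auto
  qed
qed

theorem theorem3p5:
  fixes b c :: nat
  assumes "b \<ge> 4" and "c \<ge> 4"
    and "(b mod 3 = 0 \<and> c mod 3 = 0) \<or> (b mod 3 = 1 \<and> c mod 3 = 1)"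
  shows "perfect_grid 4 b c"
proof -
  have ordered: "perfect_grid 4 d e" if "4 \<le> d" "d \<le> e"
    "(d mod 3 = 0 \<and> e mod 3 = 0) \<or> (d mod 3 = 1 \<and> e mod 3 = 1)" for d e
    using that perfect_grid_4_mod_3_eq_0 perfect_grid_4_mod_3_eq_1 by metis
  show ?thesis
  proof (cases "b \<le> c")
    case True
    with assms show ?thesis by (intro ordered)
  next
    case False
    with assms have "perfect_grid 4 c b" by (intro ordered) auto
    then show ?thesis by (rule perfect_grid_swap)
  qed
qed

end
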